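(* Assume Hypotheses 1 and 3 (see context). Then, uniformly in $z\in\mathbb C_{v_0}$ with $v_0\ge n^{-1/13}$, $s_{n,m}(z)$ converges to $s(z)$ in $L^2$, i.e. $$\sup_{z\in\mathbb C_{n^{-1/13}}}\mathbb E\big[|s_{n,m}(z)-s(z)|^2\big]\longrightarrow0,$$ where $s(z)=-\frac{1}{1+c}\Big(z-\frac{\sqrt{(z^2-c+1)^2-4z^2}}{z}\Big)=\frac{s^1(z)+cs^2(z)}{1+c}$.
   Context: Standing setup. For each $n$, $X=(X_1,\dots,X_n)$ is a random vector in $\mathbb R^n$ with law $Z_n^{-1}e^{-V(x)}\,dx$ for some $C^2$ function $V=V_n:\mathbb R^n\to\mathbb R$. Hypothesis 1: $\mathbb E[X]=0$, $\mathbb E[XX^T]=I_n$, $\mathbb E[X_i^4]=\mu$ for all $i$; $\mathrm{Hess}(V)\ge C^{-1}I_n$ for a constant $C>0$ independent of $n$; and the law of $(X_{\sigma(1)},\dots,X_{\sigma(n)})$ equals that of $(X_1,\dots,X_n)$ for every permutation $\sigma$. Hypothesis 3: $m=m(n)$ with $m/n\to c\in[1,\infty)$ and $cn-m\to\sigma\in\mathbb R$. $Y_{n,m}$ is the $n\times m$ matrix whose columns are $m$ independent copies of $X/\sqrt n$, and $W_{n,m}=\begin{pmatrix}0&Y_{n,m}^T\\ Y_{n,m}&0\end{pmatrix}$, of size $n+m$. $s_{n,m}(z)=\frac{1}{n+m}\mathrm{Tr}(W_{n,m}-z)^{-1}$. $s^1(z)=-\frac{1}{2z}\big(z^2-c+1-\sqrt{(z^2-c+1)^2-4z^2}\big)$,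 $s^2(z)=-\frac{1}{2cz}\big(z^2+c-1-\sqrt{(z^2+c-1)^2-4cz^2}\big)$, with square-root branches chosen so that $s^1,s^2$ are analytic on $\mathbb C\setminus\mathbb R$ and are Stieltjes transforms (convention $\int (x-z)^{-1}H(dx)$) of probability measures. For $v_0>0$, $\mathbb C_{v_0}=\{z=u+iv: |v|\ge v_0,\ |z|<R\}$, $R$ a fixed large constant. *)

theory Defs
  imports "HOL-Probability.Probability" "Jordan_Normal_Form.Gauss_Jordan_Elimination"
begin

definition Rn :: "nat \<Rightarrow> (nat \<Rightarrow> real) set" where
  "Rn n = PiE {..<n} (\<lambda>_. UNIV)"

definition lebesgue_Rn :: "nat \<Rightarrow> (nat \<Rightarrow> real) measure" where
  "lebesgue_Rn n = PiM {..<n} (\<lambda>_. lborel)"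

definition partial :: "nat \<Rightarrow> ((nat \<Rightarrow> real) \<Rightarrow> real) \<Rightarrow> (nat \<Rightarrow> real) \<Rightarrow> real" where
  "partial i f x = deriv (\<lambda>t. f (x(i := x i + t))) 0"

definition partial_exists :: "nat \<Rightarrow> ((nat \<Rightarrow> real) \<Rightarrow> real) \<Rightarrow> (nat \<Rightarrow> real) \<Rightarrow> bool" where
  "partial_exists i f x = ((\<lambda>t. f (x(i := x i + t))) differentiable (at 0))"

definition C2_Rn :: "nat \<Rightarrow> ((nat \<Rightarrow> real) \<Rightarrow> real) \<Rightarrow> bool" where
  "C2_Rn n f \<longleftrightarrow>
     continuous_on (Rn n) f \<and>
     (\<forall>i<n. (\<forall>x\<in>Rn n. partial_exists i f x) \<and> continuous_on (Rn n) (partial i f)) \<and>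
     (\<forall>i<n. \<forall>j<n. (\<forall>x\<in>Rn n. partial_exists j (partial i f) x) \<and>
                   continuous_on (Rn n) (partial j (partial i f)))"

definition hess :: "((nat \<Rightarrow> real) \<Rightarrow> real) \<Rightarrow> (nat \<Rightarrow> real) \<Rightarrow> nat \<Rightarrow> nat \<Rightarrow> real" where
  "hess f x i j = partial j (partial i f) x"

definition hess_ge :: "nat \<Rightarrow> ((nat \<Rightarrow> real) \<Rightarrow> real) \<Rightarrow> real \<Rightarrow> bool" where
  "hess_ge n f lam \<longleftrightarrow>
     (\<forall>x\<in>Rn n. \<forall>\<xi>::nat \<Rightarrow> real.
        (\<Sum>i<n. \<Sum>j<n. \<xi> i * \<xi> j * hess f x i j) \<ge> lam * (\<Sum>i<n. (\<xi> i)\<^sup>2))"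

definition gibbs_law :: "nat \<Rightarrow> ((nat \<Rightarrow> real) \<Rightarrow> real) \<Rightarrow> real \<Rightarrow> (nat \<Rightarrow> real) measure" where
  "gibbs_law n V Z = density (lebesgue_Rn n) (\<lambda>x. ennreal (exp (- V x) / Z))"

definition sample_space :: "nat \<Rightarrow> nat \<Rightarrow> (nat \<Rightarrow> real) measure \<Rightarrow> (nat \<Rightarrow> nat \<Rightarrow> real) measure" where
  "sample_space n m L = PiM {..<m} (\<lambda>_. L)"

text \<open>Y_{n,m}: n x m matrix, column j is the j-th copy of X divided by sqrt n.\<close>
definition Ymat :: "nat \<Rightarrow> (nat \<Rightarrow> nat \<Rightarrow> real) \<Rightarrow> nat \<Rightarrow> nat \<Rightarrow> real" where
  "Ymat n \<omega> i j = \<omega> j i / sqrt (real n)"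

text \<open>W = [[0, Y^T],[Y, 0]] of size n+m; the first m indices form the Y^T block row.\<close>
definition Wmat :: "nat \<Rightarrow> nat \<Rightarrow> (nat \<Rightarrow> nat \<Rightarrow> real) \<Rightarrow> complex mat" where
  "Wmat n m \<omega> = mat (n + m) (n + m) (\<lambda>(a, b).
      if a < m \<and> m \<le> b then complex_of_real (Ymat n \<omega> (b - m) a)
      else if m \<le> a \<and> b < m then complex_of_real (Ymat n \<omega> (a - m) b)
      else 0)"

definition snm :: "nat \<Rightarrow> nat \<Rightarrow> (nat \<Rightarrow> nat \<Rightarrow> real) \<Rightarrow> complex \<Rightarrow> complex" where
  "snm n m \<omega> z = (let G = the (mat_inverse (Wmat n m \<omega> - z \<cdot>\<^sub>m 1\<^sub>m (n + m)))
      in (\<Sum>a<n + m. G $$ (a, a)) / of_nat (n + m))"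

definition stieltjes :: "real measure \<Rightarrow> complex \<Rightarrow> complex" where
  "stieltjes H z = (\<integral>x. inverse (complex_of_real x - z) \<partial>H)"

definition is_stieltjes_of_prob :: "(complex \<Rightarrow> complex) \<Rightarrow> bool" where
  "is_stieltjes_of_prob f \<longleftrightarrow>
     (\<exists>H. prob_space H \<and> sets H = sets borel \<and> (\<forall>z. Im z \<noteq> 0 \<longrightarrow> f z = stieltjes H z))"

definition Cdom :: "real \<Rightarrow> real \<Rightarrow> complex set" where
  "Cdom R v0 = {z. \<bar>Im z\<bar> \<ge> v0 \<and> cmod z < R}"

end

theory Submission
  imports Defs "Jordan_Normal_Form.Determinant" "HOL-Real_Asymp.Real_Asymp"
begin

text \<open>
  With \<open>B = z (Y Y^T - z^2)^{-1}\<close>, \<open>s = tr B / n\<close> and \<open>B_j\<close> the same matrix without the column \<open>y_j\<close>,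
  the Sherman-Morrison formula gives \<open>1 + z s = (1/n) \<Sum>j q_j / (z + q_j)\<close> where
  \<open>q_j = y_j^T B_j y_j\<close>. Since \<open>B_j\<close> is independent of \<open>y_j\<close>, each \<open>q_j\<close> is close in mean square to
  \<open>tr B_j / n\<close>, hence to \<open>s\<close>, so \<open>s\<close> solves the quadratic equation of the limit up to a small error.
  The two roots of that equation lie in opposite half-planes and the wrong one stays at distance
  \<open>\<bar>Im z\<bar>\<close> from \<open>s\<close>, which makes the equation stable: the squared error is of order
  \<open>1 / (n \<bar>Im z\<bar>^6)\<close>.

  The concentration of \<open>q_j\<close> comes from strong convexity of \<open>V\<close> through the Prekopa-Leindler inequality
  (Maurey's property): for a quadratic form \<open>g\<close> and small \<open>t\<close>, the infimal convolution of \<open>t g\<close> with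
  a multiple of the squared distance is at least \<open>t g - O(t^2) \<bar>\<nabla>g\<bar>^2\<close>, which bounds the exponential
  moments and hence the variance of \<open>g\<close>.
\<close>


section \<open>The Prekopa-Leindler inequality\<close>

text \<open>The coordinates of a column are dependent, so the variance of \<open>q_j\<close> is not
  accessible by expanding into independent factors; strong log-concavity takes the place of
  independence. Quadratic forms are not Lipschitz, hence the restriction to small \<open>t\<close>:
  the quadratic cost must dominate \<open>t g\<close>. Matrices are measured by Frobenius norms and
  resolvents by signs of imaginary parts, so no spectral theorem appears. With v = |Im z|, the power
  v^6 is three factors v^2: the mean square of q_j - tr B_j / n is of order 1 / (n v^2) by the
  Frobenius bound on B_j, dividing by z + q_j costs v, and stability costs another v. For v >=
  n^(-1/13) this leaves n^(-7/13). The systematic error |m/n - c| / v^3 is small because c n - m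
  converges, which makes |m/n - c| of order 1/n. Every bound involves z through v alone, so
  uniformity in z needs no covering argument. The second transform is eliminated by c s2 = s1 - (c -
  1) / z, so that only one quadratic has to be shown stable.\<close>

lemma emeasure_lborel_le_if_compact_le:
  fixes A :: "real set"
  assumes A: "A \<in> sets borel"
    and le: "\<And>K. compact K \<Longrightarrow> K \<subseteq> A \<Longrightarrow> emeasure lborel K \<le> c"
  shows "emeasure lborel A \<le> c"
proof (rule ennreal_le_epsilon)
  fix e :: real assume e: "e > 0"
  have "A \<in> sets lebesgue" using A by auto
  then obtain T where T: "closed T" "T \<subseteq> A" "emeasure lebesgue (A - T) < ennreal e"
    by (rule sets_lebesgue_inner_closed[OF _ e])
  have [measurable]: "A \<in> sets borel" "T \<in> sets borel" using A T by auto
  have "emeasure lborel T = (SUP k::nat. emeasure lborel (T \<inter> {- real k..real k}))"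
  proof (subst SUP_emeasure_incseq)
    show "incseq (\<lambda>k::nat. T \<inter> {- real k..real k})" by (auto simp: incseq_def)
    have "(\<Union>k::nat. T \<inter> {- real k..real k}) = T"
    proof (intro equalityI subsetI)
      fix x assume "x \<in> T"
      moreover obtain k :: nat where "\<bar>x\<bar> \<le> real k" using real_arch_simple by blast
      ultimately show "x \<in> (\<Union>k::nat. T \<inter> {- real k..real k})"
        by (auto simp: abs_le_iff intro!: exI[of _ k])
    qed auto
    then show "emeasure lborel T = emeasure lborel (\<Union>k::nat. T \<inter> {- real k..real k})" by simp
  qed auto
  also have "\<dots> \<le> c"
    using T by (intro SUP_least le) (auto intro: closed_Int_compact)
  finally have Tc: "emeasure lborel T \<le> c" .
  have "emeasure lborel A = emeasure lborel T + emeasure lborel (A - T)"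
    using T by (subst plus_emeasure) (auto intro!: arg_cong[where f = "emeasure lborel"])
  also have "emeasure lborel (A - T) \<le> ennreal e"
    using T(3) by simp
  finally show "emeasure lborel A \<le> c + ennreal e"
    using Tc by (meson add_mono dual_order.trans order_refl)
qed

lemma emeasure_lborel_halve:
  fixes A :: "real set"
  assumes [measurable]: "A \<in> sets borel"
  shows "emeasure lborel A = 2 * emeasure lborel {u. t + 2 * u \<in> A}"
proof -
  have "emeasure lborel A = (\<integral>\<^sup>+x. indicator A x \<partial>lborel)" by simp
  also have "\<dots> = ennreal \<bar>2\<bar> * (\<integral>\<^sup>+x. indicator A (t + 2 * x) \<partial>lborel)"
    by (rule nn_integral_real_affine) auto
  also have "(\<integral>\<^sup>+x. indicator A (t + 2 * x) \<partial>lborel) = (\<integral>\<^sup>+x. indicator {u. t + 2 * u \<in> A} x \<partial>lborel)"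
    by (intro nn_integral_cong) (auto simp: indicator_def)
  also have "\<dots> = emeasure lborel {u. t + 2 * u \<in> A}"
    by (subst nn_integral_indicator) auto
  finally show ?thesis by (simp add: ennreal_numeral[symmetric] del: ennreal_numeral)
qed

text \<open>The translates \<open>A + b\<close> and \<open>a + B\<close>, with \<open>a\<close> the
  maximum of \<open>A\<close> and \<open>b\<close> the minimum of \<open>B\<close>, meet only in
  \<open>a + b\<close>. Their halves are \<open>E1\<close> and \<open>E2\<close>: both lie in
  \<open>D\<close> and they are disjoint up to the point \<open>p\<close>, so their measures
  add.\<close>

lemma brunn_minkowski_compact:
  fixes A B D :: "real set"
  assumes A: "compact A" "A \<noteq> {}" and B: "compact B" "B \<noteq> {}"
    and [measurable]: "D \<in> sets borel"
    and D: "\<And>x y. x \<in> A \<Longrightarrow> y \<in> B \<Longrightarrow> (x + y) / 2 \<in> D"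
  shows "emeasure lborel A + emeasure lborel B \<le> 2 * emeasure lborel D"
proof -
  obtain a where a: "a \<in> A" "\<And>x. x \<in> A \<Longrightarrow> x \<le> a"
    using compact_attains_sup[OF A] by blast
  obtain b where b: "b \<in> B" "\<And>x. x \<in> B \<Longrightarrow> b \<le> x"
    using compact_attains_inf[OF B] by blast
  have [measurable]: "A \<in> sets borel" "B \<in> sets borel" using A B by (auto intro: borel_compact)
  define p where "p = (a + b) / 2"
  define E1 where "E1 = {u. - b + 2 * u \<in> A}"
  define E2 where "E2 = {u. - a + 2 * u \<in> B}"
  have [measurable]: "E1 \<in> sets borel" "E2 \<in> sets borel"
    unfolding E1_def E2_def by measurable
  have E1: "E1 \<subseteq> D"
  proof
    fix u assume "u \<in> E1"
    with D[of "- b + 2 * u" b] b show "u \<in> D" by (auto simp: E1_def)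
  qed
  have E2: "E2 \<subseteq> D"
  proof
    fix u assume "u \<in> E2"
    with D[of a "- a + 2 * u"] a show "u \<in> D" by (auto simp: E2_def)
  qed
  have disj: "E1 \<inter> (E2 - {p}) = {}"
    using a b by (fastforce simp: E1_def E2_def p_def)
  have "emeasure lborel E1 + emeasure lborel E2 = emeasure lborel E1 + emeasure lborel (E2 - {p})"
    by (subst emeasure_Diff_null_set) auto
  also have "\<dots> = emeasure lborel (E1 \<union> (E2 - {p}))"
    using disj by (intro plus_emeasure) auto
  also have "\<dots> \<le> emeasure lborel D"
    using E1 E2 by (intro emeasure_mono) auto
  finally have "2 * (emeasure lborel E1 + emeasure lborel E2) \<le> 2 * emeasure lborel D"
    by (intro mult_left_mono) auto
  then show ?thesis
    using emeasure_lborel_halve[of A "- b"] emeasure_lborel_halve[of B "- a"]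
    unfolding E1_def E2_def 
    by (metis distrib_left \<open>A \<in> sets borel\<close> \<open>B \<in> sets borel\<close>)
qed

text \<open>Inner regularity, applied to one set at a time, passes from compact to Borel sets.
  \<open>D\<close> is any Borel set containing the midpoints, because the set of midpoints itself
  need not be Borel.\<close>

lemma brunn_minkowski_real:
  fixes A B D :: "real set"
  assumes A: "A \<in> sets borel" "A \<noteq> {}" and B: "B \<in> sets borel" "B \<noteq> {}"
    and D[measurable]: "D \<in> sets borel"
    and sum: "\<And>x y. x \<in> A \<Longrightarrow> y \<in> B \<Longrightarrow> (x + y) / 2 \<in> D"
  shows "emeasure lborel A + emeasure lborel B \<le> 2 * emeasure lborel D"
proof -
  obtain a b where ab: "a \<in> A" "b \<in> B" using A B by auto
  have KL: "emeasure lborel K + emeasure lborel L \<le> 2 * emeasure lborel D"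
    if "compact K" "K \<subseteq> A" "compact L" "L \<subseteq> B" for K L
  proof -
    \<comment> \<open>The sets \<open>K\<close> and \<open>L\<close> supplied by inner regularity
      may be empty; adjoining \<open>a\<close> and \<open>b\<close> repairs this.\<close>
    have K: "compact (insert a K)" "compact (insert b L)" using that by auto
    have "emeasure lborel (insert a K) + emeasure lborel (insert b L) \<le> 2 * emeasure lborel D"
      using that ab K by (intro brunn_minkowski_compact sum) auto
    moreover have "emeasure lborel K \<le> emeasure lborel (insert a K)"
      "emeasure lborel L \<le> emeasure lborel (insert b L)"
      using K by (auto intro!: emeasure_mono borel_compact)
    ultimately show ?thesis by (meson add_mono order_trans)
  qed
  have fin: "emeasure lborel K < \<infinity>" if "compact K" for K :: "real set"
    using that by (intro emeasure_bounded_finite compact_imp_bounded)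
  have KB: "emeasure lborel K + emeasure lborel B \<le> 2 * emeasure lborel D"
    if K: "compact K" "K \<subseteq> A" for K
  proof -
    have "emeasure lborel B \<le> 2 * emeasure lborel D - emeasure lborel K"
    proof (rule emeasure_lborel_le_if_compact_le[OF B(1)])
      fix L assume "compact L" "L \<subseteq> B"
      from KL[OF K this] fin[OF K(1)]
      show "emeasure lborel L \<le> 2 * emeasure lborel D - emeasure lborel K"
        by (simp add: ennreal_le_minus_iff add.commute)
    qed
    then show ?thesis
      using KL[OF K, of "{}"] fin[OF K(1)] by (auto simp add: ennreal_le_minus_iff add.commute)
  qed
  show ?thesis
  proof (cases "emeasure lborel D = \<infinity>")
    case False
    then have f: "2 * emeasure lborel D < \<infinity>" by (simp add: ennreal_mult_less_top less_top)
    have le: "emeasure lborel B \<le> 2 * emeasure lborel D" using KB[of "{}"] by simp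
    have "emeasure lborel A \<le> 2 * emeasure lborel D - emeasure lborel B"
    proof (rule emeasure_lborel_le_if_compact_le[OF A(1)])
      fix K assume "compact K" "K \<subseteq> A"
      from KB[OF this] le f
      show "emeasure lborel K \<le> 2 * emeasure lborel D - emeasure lborel B"
        by (auto simp add: ennreal_le_minus_iff add.commute)
    qed
    then show ?thesis using le f by (auto simp: ennreal_le_minus_iff add.commute)
  qed (simp add: ennreal_mult_eq_top_iff)
qed


text \<open>The layer-cake formula cut off at level 1. Brunn-Minkowski needs nonempty sets, and a
  function with supremum 1 has nonempty superlevel sets exactly below that level; for
  \<open>h\<close> the cut-off only loses mass.\<close>

lemma nn_integral_emeasure_superlevel:
  fixes f :: "real \<Rightarrow> ennreal"
  assumes [measurable]: "f \<in> borel_measurable borel"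
  shows "(\<integral>\<^sup>+t. indicator {0<..<1} t * emeasure lborel {x. ennreal t < f x} \<partial>lborel)
    = (\<integral>\<^sup>+x. min (f x) 1 \<partial>lborel)"
proof -
  have "(\<integral>\<^sup>+t. indicator {0<..<1} t * emeasure lborel {x. ennreal t < f x} \<partial>lborel)
    = (\<integral>\<^sup>+t. (\<integral>\<^sup>+x. indicator {0<..<1} t * indicator {x. ennreal t < f x} x \<partial>lborel) \<partial>lborel)"
    by (subst nn_integral_cmult) auto
  also have "\<dots> = (\<integral>\<^sup>+x. (\<integral>\<^sup>+t. indicator {0<..<1} t * indicator {x. ennreal t < f x} x \<partial>lborel) \<partial>lborel)"
    by (rule lborel_pair.Fubini') (simp add: indicator_def[abs_def])
  also have "\<dots> = (\<integral>\<^sup>+x. min (f x) 1 \<partial>lborel)"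
  proof (rule nn_integral_cong)
    fix x
    have "(\<integral>\<^sup>+t. indicator {0<..<1} t * indicator {x. ennreal t < f x} x \<partial>lborel)
      = (\<integral>\<^sup>+t. indicator {t. 0 < t \<and> t < 1 \<and> ennreal t < f x} t \<partial>lborel)"
      by (intro nn_integral_cong) (auto simp: indicator_def)
    also have "\<dots> = emeasure lborel {t::real. 0 < t \<and> t < 1 \<and> ennreal t < f x}"
      by (rule nn_integral_indicator) measurable
    also have "\<dots> = min (f x) 1"
    proof (cases "1 \<le> f x")
      case True
      then have "{t. 0 < t \<and> t < 1 \<and> ennreal t < f x} = {0<..<1}"
        by (auto intro: less_le_trans[of _ 1] simp: ennreal_less_one_iff)
      then show ?thesis using True by (simp add: min_def)
    next
      case False
      then obtain r where r: "0 \<le> r" "f x = ennreal r"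
        by (cases "f x") auto
      with False have "r < 1" by (simp add: ennreal_le_1 not_le ennreal_less_one_iff)
      with r have "{t. 0 < t \<and> t < 1 \<and> ennreal t < f x} = {0<..<r}"
        by (auto simp: ennreal_less_iff)
      then show ?thesis using r False by (simp add: min_def)
    qed
    finally show "(\<integral>\<^sup>+t. indicator {0<..<1} t * indicator {x. ennreal t < f x} x \<partial>lborel) = min (f x) 1" .
  qed
  finally show ?thesis .
qed

text \<open>Equal suprema make the superlevel sets of \<open>f\<close> and \<open>g\<close> nonempty
  for the same levels \<open>t\<close>, and midpoints of these sets lie in the superlevel set of
  \<open>h\<close>. Integrating Brunn-Minkowski over \<open>t\<close> gives the arithmetic mean,
  which is stronger than the product form.\<close>

lemma prekopa_leindler_normalized:
  fixes f g h :: "real \<Rightarrow> ennreal"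
  assumes [measurable]: "f \<in> borel_measurable borel" "g \<in> borel_measurable borel" "h \<in> borel_measurable borel"
    and f: "(SUP x. f x) = 1" and g: "(SUP x. g x) = 1"
    and le: "\<And>x y. f x * g y \<le> (h ((x + y) / 2))\<^sup>2"
  shows "(\<integral>\<^sup>+x. f x \<partial>lborel) + (\<integral>\<^sup>+x. g x \<partial>lborel) \<le> 2 * (\<integral>\<^sup>+x. h x \<partial>lborel)"
proof -
  have "f x \<le> 1" "g x \<le> 1" for x
    using f g by (metis SUP_upper UNIV_I)+
  then have fg: "min (f x) 1 = f x" "min (g x) 1 = g x" for x
    by (auto simp: min_def)
  let ?E = "\<lambda>f t. emeasure lborel {x::real. ennreal t < f x}"
  have key: "?E f t + ?E g t \<le> 2 * ?E h t" if t: "0 < t" "t < 1" for t :: real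
  proof (rule brunn_minkowski_real)
    have t1: "ennreal t < 1" using t by (simp add: ennreal_less_one_iff)
    with f g show "{x. ennreal t < f x} \<noteq> {}" "{x. ennreal t < g x} \<noteq> {}"
      by (metis (mono_tags, lifting) less_SUP_iff mem_Collect_eq empty_iff)+
    fix x y assume xy: "x \<in> {x. ennreal t < f x}" "y \<in> {x. ennreal t < g x}"
    have "ennreal t * ennreal t < ennreal t * g y"
      using xy t by (intro ennreal_mult_strict_left_mono) auto
    also have "\<dots> \<le> f x * g y" using xy by (intro mult_right_mono) auto
    also have "\<dots> \<le> (h ((x + y) / 2))\<^sup>2" by (rule le)
    finally have "(ennreal t)\<^sup>2 < (h ((x + y) / 2))\<^sup>2" by (simp add: power2_eq_square)
    then have "\<not> h ((x + y) / 2) \<le> ennreal t"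
      by (meson not_le power_mono zero_le)
    then show "(x + y) / 2 \<in> {x. ennreal t < h x}" by simp
  qed measurable
  have "(\<integral>\<^sup>+x. f x \<partial>lborel) + (\<integral>\<^sup>+x. g x \<partial>lborel)
    = (\<integral>\<^sup>+t. indicator {0<..<1} t * ?E f t \<partial>lborel) + (\<integral>\<^sup>+t. indicator {0<..<1} t * ?E g t \<partial>lborel)"
    by (simp add: nn_integral_emeasure_superlevel fg)
  also have "\<dots> = (\<integral>\<^sup>+t. indicator {0<..<1} t * ?E f t + indicator {0<..<1} t * ?E g t \<partial>lborel)"
    by (rule nn_integral_add[symmetric]) measurable
  also have "\<dots> \<le> (\<integral>\<^sup>+t. 2 * (indicator {0<..<1} t * ?E h t) \<partial>lborel)"
    using key by (intro nn_integral_mono) (auto simp: indicator_def)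
  also have "\<dots> = 2 * (\<integral>\<^sup>+t. indicator {0<..<1} t * ?E h t \<partial>lborel)"
    by (rule nn_integral_cmult) measurable
  also have "\<dots> \<le> 2 * (\<integral>\<^sup>+x. h x \<partial>lborel)"
    by (subst nn_integral_emeasure_superlevel) (auto intro!: mult_left_mono nn_integral_mono)
  finally show ?thesis .
qed

lemma ennreal_four_mult_le_square_sum: "4 * (x * y) \<le> (x + y)\<^sup>2" for x y :: ennreal
proof (cases "x = \<infinity> \<or> y = \<infinity>")
  case False
  then obtain a b where "x = ennreal a" "y = ennreal b" "0 \<le> a" "0 \<le> b"
    by (metis ennreal_cases infinity_ennreal_def)
  moreover have "4 * (a * b) \<le> (a + b)\<^sup>2"
    using zero_le_power2[of "a - b"] by (simp add: power2_eq_square algebra_simps)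
  ultimately show ?thesis
    by (simp add: ennreal_mult[symmetric] ennreal_plus[symmetric] ennreal_power
        ennreal_numeral[symmetric] del: ennreal_plus ennreal_numeral)
qed (auto simp: power2_eq_square ennreal_mult_top ennreal_top_mult)

text \<open>Boundedness makes the suprema \<open>a\<close> and \<open>b\<close> finite, so
  \<open>f\<close> and \<open>g\<close> can be scaled to supremum 1; scaling \<open>h\<close> by
  \<open>c\<close> with \<open>c * c = 1 / a * (1 / b)\<close> preserves the hypothesis. The
  inequality between arithmetic and geometric mean then turns the sum into the product.\<close>

lemma prekopa_leindler_bounded:
  fixes f g h :: "real \<Rightarrow> ennreal"
  assumes [measurable]: "f \<in> borel_measurable borel" "g \<in> borel_measurable borel" "h \<in> borel_measurable borel"
    and f: "\<And>x. f x \<le> ennreal k" and g: "\<And>x. g x \<le> ennreal k"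
    and le: "\<And>x y. f x * g y \<le> (h ((x + y) / 2))\<^sup>2"
  shows "(\<integral>\<^sup>+x. f x \<partial>lborel) * (\<integral>\<^sup>+x. g x \<partial>lborel) \<le> (\<integral>\<^sup>+x. h x \<partial>lborel)\<^sup>2"
proof -
  have "(SUP x. f x) \<le> ennreal k" "(SUP x. g x) \<le> ennreal k"
    using f g by (auto intro: SUP_least)
  then obtain a b where ab: "(SUP x. f x) = ennreal a" "(SUP x. g x) = ennreal b" "0 \<le> a" "0 \<le> b"
    by (metis ennreal_cases ennreal_less_top leD top.not_eq_extremum)
  show ?thesis
  proof (cases "a = 0 \<or> b = 0")
    case True
    then have "(\<forall>x. f x = 0) \<or> (\<forall>x. g x = 0)"
      using ab by (metis SUP_upper UNIV_I ennreal_0 le_zero_eq)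
    then show ?thesis by auto
  next
    case False
    with ab have pos: "a > 0" "b > 0" by auto
    define c where "c = 1 / sqrt (a * b)"
    have cc: "c * c = (1 / a) * (1 / b)" "0 \<le> c" using pos by (simp_all add: c_def)
    let ?f = "\<lambda>x. ennreal (1 / a) * f x" and ?g = "\<lambda>x. ennreal (1 / b) * g x"
    let ?F = "\<integral>\<^sup>+x. f x \<partial>lborel" and ?G = "\<integral>\<^sup>+x. g x \<partial>lborel" and ?H = "\<integral>\<^sup>+x. h x \<partial>lborel"
    have cc': "ennreal c * ennreal c = ennreal (1 / a) * ennreal (1 / b)"
      using cc pos by (simp add: ennreal_mult[symmetric])
    have "(\<integral>\<^sup>+x. ?f x \<partial>lborel) + (\<integral>\<^sup>+x. ?g x \<partial>lborel) \<le> 2 * (\<integral>\<^sup>+x. ennreal c * h x \<partial>lborel)"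
    proof (rule prekopa_leindler_normalized)
      show "(SUP x. ?f x) = 1" "(SUP x. ?g x) = 1"
        using pos ab by (simp_all add: SUP_mult_left_ennreal[symmetric] ennreal_mult[symmetric])
      fix x y
      have "?f x * ?g y = (ennreal c * ennreal c) * (f x * g y)"
        unfolding cc' by (simp add: mult_ac)
      also have "\<dots> \<le> (ennreal c * ennreal c) * (h ((x + y) / 2))\<^sup>2"
        by (intro mult_left_mono le) auto
      finally show "?f x * ?g y \<le> (ennreal c * h ((x + y) / 2))\<^sup>2"
        by (simp add: power2_eq_square mult_ac)
    qed measurable
    then have S: "ennreal (1 / a) * ?F + ennreal (1 / b) * ?G \<le> 2 * (ennreal c * ?H)"
      by (simp add: nn_integral_cmult)
    have "4 * ((ennreal (1 / a) * ?F) * (ennreal (1 / b) * ?G))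
      \<le> (ennreal (1 / a) * ?F + ennreal (1 / b) * ?G)\<^sup>2"
      by (rule ennreal_four_mult_le_square_sum)
    also have "\<dots> \<le> (2 * (ennreal c * ?H))\<^sup>2"
      by (rule power_mono[OF S]) simp
    also have "\<dots> = 4 * ((ennreal c * ennreal c) * ?H\<^sup>2)"
      by (simp add: power2_eq_square mult_ac)
    finally have le: "4 * ((ennreal (1 / a) * ?F) * (ennreal (1 / b) * ?G))
      \<le> 4 * ((ennreal c * ennreal c) * ?H\<^sup>2)" .
    have "4 * ((ennreal (1 / a) * ?F) * (ennreal (1 / b) * ?G)) = 4 * ((ennreal c * ennreal c) * (?F * ?G))"
      unfolding cc' by (simp add: mult_ac)
    with le have le': "4 * ((ennreal c * ennreal c) * (?F * ?G)) \<le> 4 * ((ennreal c * ennreal c) * ?H\<^sup>2)"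
      by simp
    have "ennreal (a * b / 4) * (4 * ((ennreal c * ennreal c) * (?F * ?G)))
      \<le> ennreal (a * b / 4) * (4 * ((ennreal c * ennreal c) * ?H\<^sup>2))"
      by (rule mult_left_mono[OF le']) simp
    moreover have "ennreal (a * b / 4) * (4 * ((ennreal c * ennreal c) * X)) = X" for X
    proof -
      have "ennreal (a * b / 4) * (4 * ((ennreal c * ennreal c) * X))
        = ennreal (a * b / 4) * (ennreal 4 * (ennreal (c * c) * X))"
        by (simp only: ennreal_mult[OF cc(2) cc(2)] ennreal_numeral)
      also have "\<dots> = ennreal (a * b / 4 * (4 * (c * c))) * X"
      proof -
        have "0 \<le> a * b / 4" "0 \<le> c * c" "0 \<le> 4 * (c * c)" using pos by auto
        then show ?thesis by (simp add: ennreal_mult mult.assoc del: times_divide_eq_left)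
      qed
      also have "a * b / 4 * (4 * (c * c)) = 1" using pos by (simp add: cc(1))
      finally show ?thesis by simp
    qed
    ultimately show ?thesis by simp
  qed
qed

lemma prekopa_leindler_real:
  fixes f g h :: "real \<Rightarrow> ennreal"
  assumes [measurable]: "f \<in> borel_measurable borel" "g \<in> borel_measurable borel" "h \<in> borel_measurable borel"
    and le: "\<And>x y. f x * g y \<le> (h ((x + y) / 2))\<^sup>2"
  shows "(\<integral>\<^sup>+x. f x \<partial>lborel) * (\<integral>\<^sup>+x. g x \<partial>lborel) \<le> (\<integral>\<^sup>+x. h x \<partial>lborel)\<^sup>2"
proof -
  have trunc: "(\<integral>\<^sup>+x. f x \<partial>lborel) = (SUP k::nat. \<integral>\<^sup>+x. min (f x) (ennreal (real k)) \<partial>lborel)"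
    if [measurable]: "f \<in> borel_measurable borel" for f :: "real \<Rightarrow> ennreal"
  proof -
    have "(SUP k::nat. min (f x) (ennreal (real k))) = f x" for x
    proof (rule antisym)
      have "f x = inf (f x) (SUP k::nat. ennreal (real k))"
        by (simp add: ennreal_SUP_of_nat_eq_top ennreal_of_nat_eq_real_of_nat[symmetric])
      also have "\<dots> = (SUP k::nat. inf (f x) (ennreal (real k)))"
        by (simp add: inf_SUP)
      finally show "f x \<le> (SUP k::nat. min (f x) (ennreal (real k)))" by (simp add: inf_min)
    qed (auto intro: SUP_least)
    then have "(\<integral>\<^sup>+x. f x \<partial>lborel) = (\<integral>\<^sup>+x. (SUP k::nat. min (f x) (ennreal (real k))) \<partial>lborel)" by simp
    also have "\<dots> = (SUP k::nat. \<integral>\<^sup>+x. min (f x) (ennreal (real k)) \<partial>lborel)"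
      by (rule nn_integral_monotone_convergence_SUP)
         (auto simp: incseq_def le_fun_def min_def intro: order_trans ennreal_leI)
    finally show ?thesis .
  qed
  let ?T = "\<lambda>f k. \<integral>\<^sup>+x. min (f x) (ennreal (real k)) \<partial>lborel"
  have b: "?T f k * ?T g l \<le> (\<integral>\<^sup>+x. h x \<partial>lborel)\<^sup>2" for k l
  proof (rule prekopa_leindler_bounded[where k = "real (max k l)"])
    fix x y
    have "min (f x) (ennreal (real k)) * min (g y) (ennreal (real l)) \<le> f x * g y"
      by (intro mult_mono) auto
    with le[of x y] show "min (f x) (ennreal (real k)) * min (g y) (ennreal (real l)) \<le> (h ((x + y) / 2))\<^sup>2"
      by (rule order_trans[rotated])
  qed (auto simp: min_le_iff_disj intro!: disjI2 ennreal_leI)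
  show ?thesis
    unfolding trunc[OF assms(1)] trunc[OF assms(2)]
    by (subst SUP_mult_right_ennreal, rule SUP_least, subst SUP_mult_left_ennreal, rule SUP_least, rule b)
qed


text \<open>Tensorization: integrating out the first \<open>n\<close> coordinates leaves three
  functions of the last one, and the induction hypothesis is exactly the one-dimensional hypothesis
  for them.\<close>

lemma prekopa_leindler:
  fixes f g h :: "(nat \<Rightarrow> real) \<Rightarrow> ennreal"
  assumes "f \<in> borel_measurable (Pi\<^sub>M {..<n} (\<lambda>_. lborel))"
    and "g \<in> borel_measurable (Pi\<^sub>M {..<n} (\<lambda>_. lborel))"
    and "h \<in> borel_measurable (Pi\<^sub>M {..<n} (\<lambda>_. lborel))"
    and "\<And>x y. x \<in> PiE {..<n} (\<lambda>_. UNIV) \<Longrightarrow> y \<in> PiE {..<n} (\<lambda>_. UNIV) \<Longrightarrow>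
      f x * g y \<le> (h (\<lambda>i\<in>{..<n}. (x i + y i) / 2))\<^sup>2"
  shows "(\<integral>\<^sup>+x. f x \<partial>Pi\<^sub>M {..<n} (\<lambda>_. lborel)) * (\<integral>\<^sup>+x. g x \<partial>Pi\<^sub>M {..<n} (\<lambda>_. lborel))
    \<le> (\<integral>\<^sup>+x. h x \<partial>Pi\<^sub>M {..<n} (\<lambda>_. lborel))\<^sup>2"
  using assms
proof (induction n arbitrary: f g h)
  case 0
  interpret product_sigma_finite "\<lambda>_::nat. lborel :: real measure" ..
  \<comment> \<open>The zero-dimensional space has a single point, the constantly
    \<open>undefined\<close> function.\<close>
  from 0(4)[of "\<lambda>_. undefined" "\<lambda>_. undefined"] show ?case
    by (simp add: nn_integral_empty restrict_def)
next
  case (Suc n)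
  interpret product_sigma_finite "\<lambda>_::nat. lborel :: real measure" ..
  interpret P: finite_product_sigma_finite "\<lambda>_::nat. lborel :: real measure" "{..<n}"
    by standard auto
  have ins: "{..<Suc n} = insert n {..<n}" by auto
  note [measurable] = Suc.prems(1-3)[unfolded ins]
  let ?P = "Pi\<^sub>M {..<n} (\<lambda>_. lborel :: real measure)"
  have split: "integral\<^sup>N (Pi\<^sub>M {..<Suc n} (\<lambda>_. lborel)) f = (\<integral>\<^sup>+t. (\<integral>\<^sup>+x. f (x(n := t)) \<partial>?P) \<partial>lborel)"
    if "f \<in> borel_measurable (Pi\<^sub>M (insert n {..<n}) (\<lambda>_. lborel))" for f :: "(nat \<Rightarrow> real) \<Rightarrow> ennreal"
    unfolding ins using that by (intro product_nn_integral_insert_rev) auto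
  show ?case
    unfolding split[OF Suc.prems(1)[unfolded ins]] split[OF Suc.prems(2)[unfolded ins]]
      split[OF Suc.prems(3)[unfolded ins]]
  proof (rule prekopa_leindler_real)
    fix s t :: real
    show "(\<integral>\<^sup>+x. f (x(n := s)) \<partial>?P) * (\<integral>\<^sup>+x. g (x(n := t)) \<partial>?P)
      \<le> (\<integral>\<^sup>+x. h (x(n := (s + t) / 2)) \<partial>?P)\<^sup>2"
    proof (rule Suc.IH)
      fix x y :: "nat \<Rightarrow> real"
      assume xy: "x \<in> PiE {..<n} (\<lambda>_. UNIV)" "y \<in> PiE {..<n} (\<lambda>_. UNIV)"
      then have "x(n := s) \<in> PiE {..<Suc n} (\<lambda>_. UNIV)" "y(n := t) \<in> PiE {..<Suc n} (\<lambda>_. UNIV)"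
        by (auto simp: PiE_def extensional_def)
      from Suc.prems(4)[OF this]
      have "f (x(n := s)) * g (y(n := t))
        \<le> (h (\<lambda>i\<in>{..<Suc n}. ((x(n := s)) i + (y(n := t)) i) / 2))\<^sup>2" .
      also have "(\<lambda>i\<in>{..<Suc n}. ((x(n := s)) i + (y(n := t)) i) / 2)
        = (\<lambda>i\<in>{..<n}. (x i + y i) / 2)(n := (s + t) / 2)"
        by (auto simp: fun_eq_iff restrict_def)
      finally show "f (x(n := s)) * g (y(n := t))
        \<le> (h ((\<lambda>i\<in>{..<n}. (x i + y i) / 2)(n := (s + t) / 2)))\<^sup>2" .
    qed measurable
  qed measurable
qed

section \<open>Convexity along segments\<close>

lemma Rn_upd: "x \<in> Rn n \<Longrightarrow> k < n \<Longrightarrow> x(k := u) \<in> Rn n"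
  by (auto simp: Rn_def PiE_def extensional_def)

lemma restrict_in_Rn [simp]: "restrict f {..<n} \<in> Rn n"
  by (simp add: Rn_def)

text \<open>Continuity in \<open>C2_Rn\<close> refers to the product topology on all functions.
  Points of \<open>Rn n\<close> agree outside \<open>{..<n}\<close>, so only finitely many
  coordinates count and one radius serves them all.\<close>

lemma continuous_on_Rn_eps_delta:
  fixes g :: "(nat \<Rightarrow> real) \<Rightarrow> real"
  assumes g: "continuous_on (Rn n) g" and p: "p \<in> Rn n" and e: "e > 0"
  obtains d where "d > 0" "\<And>q. q \<in> Rn n \<Longrightarrow> (\<And>i. i < n \<Longrightarrow> \<bar>q i - p i\<bar> < d) \<Longrightarrow> \<bar>g q - g p\<bar> < e"
proof -
  obtain U where U: "open U" "U \<inter> Rn n = g -` ball (g p) e \<inter> Rn n"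
    using g by (auto simp: continuous_on_open_invariant open_ball)
  have "p \<in> U" using U(2) p e by auto
  then obtain X where X: "p \<in> (\<Pi>\<^sub>E i\<in>UNIV. X i)" "\<And>i. open (X i)" "(\<Pi>\<^sub>E i\<in>UNIV. X i) \<subseteq> U"
    using product_topology_open_contains_basis[of "\<lambda>_. euclidean" UNIV U p] U(1)
    by (auto simp: open_fun_def)
  have "\<exists>d>0. \<forall>u. \<bar>u - p i\<bar> < d \<longrightarrow> u \<in> X i" for i
  proof -
    have "p i \<in> X i" using X(1) by auto
    then show ?thesis using X(2)[of i] by (auto simp: open_dist dist_real_def)
  qed
  then obtain D where D: "\<And>i. D i > 0" "\<And>i u. \<bar>u - p i\<bar> < D i \<Longrightarrow> u \<in> X i" by metis
  \<comment> \<open>Inserting 1 keeps the set nonempty when \<open>n = 0\<close>.\<close>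
  define d where "d = Min (insert 1 (D ` {..<n}))"
  have d: "d > 0" "\<And>i. i < n \<Longrightarrow> d \<le> D i" using D(1) by (auto simp: d_def)
  show thesis
  proof (rule that[OF d(1)])
    fix q assume q: "q \<in> Rn n" and close: "\<And>i. i < n \<Longrightarrow> \<bar>q i - p i\<bar> < d"
    have "q i \<in> X i" for i
    proof (cases "i < n")
      case True
      then show ?thesis using close[of i] d(2)[of i] D(2) by force
    next
      case False
      then have "q i = p i" using p q by (auto simp: Rn_def PiE_def extensional_def)
      then show ?thesis using D by simp
    qed
    then have "q \<in> U" using X(3) by auto
    with q U(2) have "q \<in> g -` ball (g p) e" by blast
    then show "\<bar>g q - g p\<bar> < e" by (simp add: dist_real_def abs_minus_commute)
  qed
qed

lemma partial_has_derivative: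
  assumes "partial_exists k f (x(k := u))"
  shows "((\<lambda>u. f (x(k := u))) has_real_derivative partial k f (x(k := u))) (at u)"
proof -
  have "((\<lambda>t. f (x(k := u + t))) has_real_derivative partial k f (x(k := u))) (at 0)"
    using assms unfolding partial_exists_def partial_def
    by (simp add: DERIV_deriv_iff_real_differentiable)
  then show ?thesis
    using DERIV_shift[of "\<lambda>u. f (x(k := u))" _ 0 u] by (simp add: add.commute)
qed

text \<open>\<open>C2_Rn\<close> speaks of partial derivatives only, so the chain rule comes from
  telescoping: \<open>P k h\<close> has its first \<open>k\<close> coordinates moved, each single
  move is governed by the mean value theorem at an intermediate point \<open>Q k h\<close>, and
  continuity of the partial derivatives gives the limit.\<close>

lemma has_derivative_along_line:
  fixes f :: "(nat \<Rightarrow> real) \<Rightarrow> real"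
  assumes ex: "\<And>i x. i < n \<Longrightarrow> x \<in> Rn n \<Longrightarrow> partial_exists i f x"
    and cont: "\<And>i. i < n \<Longrightarrow> continuous_on (Rn n) (partial i f)"
  shows "((\<lambda>t. f (\<lambda>i\<in>{..<n}. x i + t * \<xi> i)) has_real_derivative
    (\<Sum>i<n. \<xi> i * partial i f (\<lambda>i\<in>{..<n}. x i + s * \<xi> i))) (at s)"
proof -
  define p where "p = (\<lambda>i\<in>{..<n}. x i + s * \<xi> i)"
  have p: "p \<in> Rn n" by (simp add: p_def)
  define P where "P k h = (\<lambda>i\<in>{..<n}. if i < k then p i + h * \<xi> i else p i)" for k h
  have PRn: "P k h \<in> Rn n" for k h by (simp add: P_def)
  have "\<exists>q\<in>Rn n. (\<forall>i<n. \<bar>q i - p i\<bar> \<le> \<bar>h\<bar> * \<bar>\<xi> i\<bar>) \<and>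
      f (P (Suc k) h) - f (P k h) = h * (\<xi> k * partial k f q)" if k: "k < n" for k h
  proof -
    define \<phi> where "\<phi> \<tau> = f ((P k h)(k := p k + \<tau> * (h * \<xi> k)))" for \<tau>
    define Q where "Q \<tau> = (P k h)(k := p k + \<tau> * (h * \<xi> k))" for \<tau>
    have QRn: "Q \<tau> \<in> Rn n" for \<tau> using k PRn by (simp add: Q_def Rn_upd)
    have "(\<phi> has_real_derivative partial k f (Q \<tau>) * (h * \<xi> k)) (at \<tau>)" for \<tau>
      unfolding \<phi>_def Q_def
      by (rule DERIV_chain2[where f = "\<lambda>u. f ((P k h)(k := u))" and g = "\<lambda>\<tau>. p k + \<tau> * (h * \<xi> k)"])
         (use k QRn in \<open>auto intro!: partial_has_derivative ex derivative_eq_intros simp: Q_def\<close>)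
    then obtain \<theta> where \<theta>: "0 < \<theta>" "\<theta> < 1" "\<phi> 1 - \<phi> 0 = (1 - 0) * (partial k f (Q \<theta>) * (h * \<xi> k))"
      using MVT2[of 0 1 \<phi> "\<lambda>\<tau>. partial k f (Q \<tau>) * (h * \<xi> k)"] by auto
    have "P (Suc k) h = (P k h)(k := p k + h * \<xi> k)" "P k h = (P k h)(k := p k)"
      using k by (auto simp: P_def fun_eq_iff restrict_def less_Suc_eq)
    then have "f (P (Suc k) h) - f (P k h) = \<phi> 1 - \<phi> 0" by (simp add: \<phi>_def)
    moreover have "\<bar>Q \<theta> i - p i\<bar> \<le> \<bar>h\<bar> * \<bar>\<xi> i\<bar>" if "i < n" for i
      using \<theta> that by (auto simp: Q_def P_def abs_mult intro!: mult_left_le_one_le)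
    ultimately show ?thesis using \<theta>(3) QRn[of \<theta>] by (intro bexI[of _ "Q \<theta>"]) auto
  qed
  then obtain Q where Q: "\<And>k h. k < n \<Longrightarrow> Q k h \<in> Rn n"
      "\<And>k h i. k < n \<Longrightarrow> i < n \<Longrightarrow> \<bar>Q k h i - p i\<bar> \<le> \<bar>h\<bar> * \<bar>\<xi> i\<bar>"
      "\<And>k h. k < n \<Longrightarrow> f (P (Suc k) h) - f (P k h) = h * (\<xi> k * partial k f (Q k h))"
    by metis
  have lim: "((\<lambda>h. partial k f (Q k h)) \<longlongrightarrow> partial k f p) (at 0)" if k: "k < n" for k
  proof (rule tendstoI)
    fix e :: real assume "e > 0"
    then obtain d where d: "d > 0"
      "\<And>q. q \<in> Rn n \<Longrightarrow> (\<And>i. i < n \<Longrightarrow> \<bar>q i - p i\<bar> < d) \<Longrightarrow> \<bar>partial k f q - partial k f p\<bar> < e"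
      using continuous_on_Rn_eps_delta[OF cont[OF k] p] by blast
    \<comment> \<open>The summand 1 keeps \<open>K\<close> positive, so that \<open>d / K\<close> is
      a radius even for a zero direction.\<close>
    define K where "K = 1 + (\<Sum>i<n. \<bar>\<xi> i\<bar>)"
    have K: "K > 0" "\<And>i. i < n \<Longrightarrow> \<bar>\<xi> i\<bar> \<le> K"
      by (auto simp: K_def intro!: add_pos_nonneg sum_nonneg add_increasing member_le_sum)
    have "\<bar>partial k f (Q k h) - partial k f p\<bar> < e" if h: "\<bar>h\<bar> < d / K" for h
    proof (rule d(2)[OF Q(1)[OF k]])
      fix i assume i: "i < n"
      have "\<bar>Q k h i - p i\<bar> \<le> \<bar>h\<bar> * K"
        using Q(2)[OF k i, of h] mult_left_mono[OF K(2)[OF i], of "\<bar>h\<bar>"] by linarith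
      also have "\<dots> < d" using h K by (simp add: pos_less_divide_eq)
      finally show "\<bar>Q k h i - p i\<bar> < d" .
    qed
    then show "\<forall>\<^sub>F h in at 0. dist (partial k f (Q k h)) (partial k f p) < e"
      using d(1) K(1) unfolding eventually_at dist_real_def
      by (intro exI[of _ "d / K"]) auto
  qed
  have quot: "(f (\<lambda>i\<in>{..<n}. x i + (s + h) * \<xi> i) - f p) / h = (\<Sum>k<n. \<xi> k * partial k f (Q k h))"
    if "h \<noteq> 0" for h
  proof -
    have "(\<lambda>i\<in>{..<n}. x i + (s + h) * \<xi> i) = P n h" "p = P 0 h"
      by (auto simp: P_def p_def fun_eq_iff algebra_simps)
    then have "f (\<lambda>i\<in>{..<n}. x i + (s + h) * \<xi> i) - f p = f (P n h) - f (P 0 h)" by simp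
    also have "\<dots> = (\<Sum>k<n. f (P (Suc k) h) - f (P k h))"
      by (rule sum_lessThan_telescope[symmetric])
    also have "\<dots> = h * (\<Sum>k<n. \<xi> k * partial k f (Q k h))"
      by (simp add: Q(3) sum_distrib_left)
    finally show ?thesis using that by simp
  qed
  have "((\<lambda>h. \<Sum>k<n. \<xi> k * partial k f (Q k h)) \<longlongrightarrow> (\<Sum>k<n. \<xi> k * partial k f p)) (at 0)"
    by (intro tendsto_sum tendsto_mult tendsto_const lim) auto
  then have "((\<lambda>h. (f (\<lambda>i\<in>{..<n}. x i + (s + h) * \<xi> i) - f p) / h) \<longlongrightarrow> (\<Sum>k<n. \<xi> k * partial k f p)) (at 0)"
    by (rule Lim_transform_eventually) (auto simp: eventually_at quot intro!: exI[of _ 1])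
  then show ?thesis
    unfolding DERIV_def p_def .
qed

text \<open>Along the segment, \<open>V\<close> minus the parabola \<open>N * t\<^sup>2 / 2\<close>
  has nonnegative second derivative. The parabola equals \<open>N / 8\<close> at the midpoint and
  averages \<open>N / 4\<close> over the ends, which leaves a gain of \<open>N / 8\<close>.\<close>

lemma midpoint_strongly_convex:
  assumes C2: "C2_Rn n V" and hess: "hess_ge n V \<kappa>" and x: "x \<in> Rn n" and y: "y \<in> Rn n"
  shows "V (\<lambda>i\<in>{..<n}. (x i + y i) / 2) \<le> (V x + V y) / 2 - \<kappa> / 8 * (\<Sum>i<n. (y i - x i)\<^sup>2)"
proof -
  define \<xi> where "\<xi> i = y i - x i" for i
  define L where "L t = (\<lambda>i\<in>{..<n}. x i + t * \<xi> i)" for t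
  define N where "N = \<kappa> * (\<Sum>i<n. (\<xi> i)\<^sup>2)"
  have d1: "((\<lambda>t. V (L t)) has_real_derivative (\<Sum>i<n. \<xi> i * partial i V (L t))) (at t)" for t
    unfolding L_def by (rule has_derivative_along_line) (use C2 in \<open>auto simp: C2_Rn_def\<close>)
  have "((\<lambda>t. partial i V (L t)) has_real_derivative (\<Sum>j<n. \<xi> j * partial j (partial i V) (L t))) (at t)"
    if "i < n" for i t
    unfolding L_def by (rule has_derivative_along_line) (use C2 that in \<open>auto simp: C2_Rn_def\<close>)
  then have d2: "((\<lambda>t. \<Sum>i<n. \<xi> i * partial i V (L t)) has_real_derivative
      (\<Sum>i<n. \<xi> i * (\<Sum>j<n. \<xi> j * partial j (partial i V) (L t)))) (at t)" for t
    by (intro DERIV_sum DERIV_cmult) auto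
  have "convex_on UNIV (\<lambda>t. V (L t) - N * t\<^sup>2 / 2)"
  proof (rule f''_ge0_imp_convex)
    fix t :: real
    show "((\<lambda>t. V (L t) - N * t\<^sup>2 / 2) has_real_derivative (\<Sum>i<n. \<xi> i * partial i V (L t)) - N * t) (at t)"
      by (auto intro!: derivative_eq_intros d1)
    show "((\<lambda>t. (\<Sum>i<n. \<xi> i * partial i V (L t)) - N * t) has_real_derivative
        (\<Sum>i<n. \<xi> i * (\<Sum>j<n. \<xi> j * partial j (partial i V) (L t))) - N) (at t)"
      by (rule DERIV_diff[OF d2 DERIV_cmult_Id])
    have "N \<le> (\<Sum>i<n. \<Sum>j<n. \<xi> i * \<xi> j * hess V (L t) i j)"
      using hess by (auto simp: hess_ge_def N_def L_def)
    then show "0 \<le> (\<Sum>i<n. \<xi> i * (\<Sum>j<n. \<xi> j * partial j (partial i V) (L t))) - N"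
      by (simp add: hess_def sum_distrib_left mult.assoc)
  qed auto
  from convex_onD[OF this, of "1/2" 0 1]
  have "V (L (1/2)) - N / 8 \<le> V (L 0) / 2 + (V (L 1) - N / 2) / 2"
    by (simp add: power2_eq_square)
  moreover have "L 0 = x" "L 1 = y" "L (1/2) = (\<lambda>i\<in>{..<n}. (x i + y i) / 2)"
    using x y by (auto simp: L_def \<xi>_def Rn_def fun_eq_iff PiE_def extensional_def restrict_def field_simps)
  ultimately show ?thesis by (simp add: N_def \<xi>_def field_simps)
qed

text \<open>\<open>lebesgue_Rn n\<close> carries the product sigma-algebra over
  \<open>{..<n}\<close>, while continuity refers to the space of all functions; the inclusion is
  measurable because the remaining coordinates are constant on \<open>Rn n\<close>.\<close>

lemma measurable_continuous_on_Rn: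
  fixes f :: "(nat \<Rightarrow> real) \<Rightarrow> real"
  assumes "continuous_on (Rn n) f"
  shows "f \<in> borel_measurable (lebesgue_Rn n)"
proof -
  have sp: "space (lebesgue_Rn n) = Rn n"
    by (simp add: lebesgue_Rn_def Rn_def space_PiM)
  have "(\<lambda>x. x) \<in> measurable (lebesgue_Rn n) (borel :: (nat \<Rightarrow> real) measure)"
  proof (rule measurable_coordinatewise_then_product)
    fix i
    show "(\<lambda>x. x i) \<in> borel_measurable (lebesgue_Rn n)"
    proof (cases "i < n")
      case True
      then have "(\<lambda>x. x i) \<in> measurable (lebesgue_Rn n) lborel"
        unfolding lebesgue_Rn_def by (intro measurable_component_singleton) simp
      then show ?thesis by simp
    next
      case False
      then show ?thesis
        by (subst measurable_cong[where g = "\<lambda>_. undefined"])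
           (auto simp: sp Rn_def PiE_def extensional_def)
    qed
  qed
  then have "(\<lambda>x. x) \<in> measurable (lebesgue_Rn n) (restrict_space borel (Rn n))"
    by (intro measurable_restrict_space2) (auto simp: sp)
  from measurable_compose[OF this borel_measurable_continuous_on_restrict[OF assms]]
  show ?thesis .
qed

section \<open>Concentration of quadratic forms\<close>

lemma measurable_coordinate_Rn [measurable (raw)]:
  "i < n \<Longrightarrow> (\<lambda>x. x i) \<in> borel_measurable (lebesgue_Rn n)"
proof -
  assume "i < n"
  then have "(\<lambda>x. x i) \<in> measurable (lebesgue_Rn n) lborel"
    unfolding lebesgue_Rn_def by (intro measurable_component_singleton) simp
  then show ?thesis by simp
qed

lemma sets_gibbs_law [simp, measurable_cong]: "sets (gibbs_law n V Z) = sets (lebesgue_Rn n)"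
  by (simp add: gibbs_law_def)

text \<open>Prekopa-Leindler for \<open>exp (a - V)\<close>, \<open>exp (b - V)\<close> and
  \<open>exp (- V)\<close>. The square of the third function doubles the gain
  \<open>\<kappa> / 8\<close> of strong convexity at the midpoint; the resulting
  \<open>\<kappa> / 4\<close> is the cost that \<open>a x + b y\<close> may use up.\<close>

lemma maurey_property:
  assumes C2: "C2_Rn n V" and hess: "hess_ge n V \<kappa>" and Z: "Z > 0"
    and prob: "prob_space (gibbs_law n V Z)"
    and [measurable]: "a \<in> borel_measurable (lebesgue_Rn n)" "b \<in> borel_measurable (lebesgue_Rn n)"
    and ab: "\<And>x y. x \<in> Rn n \<Longrightarrow> y \<in> Rn n \<Longrightarrow> a x + b y \<le> \<kappa> / 4 * (\<Sum>i<n. (y i - x i)\<^sup>2)"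
  shows "(\<integral>\<^sup>+x. ennreal (exp (a x)) \<partial>gibbs_law n V Z) * (\<integral>\<^sup>+x. ennreal (exp (b x)) \<partial>gibbs_law n V Z) \<le> 1"
proof -
  have V[measurable]: "V \<in> borel_measurable (lebesgue_Rn n)"
    using C2 by (intro measurable_continuous_on_Rn) (simp add: C2_Rn_def)
  let ?d = "\<lambda>x. ennreal (exp (- V x) / Z)"
  have dens: "(\<integral>\<^sup>+x. u x \<partial>gibbs_law n V Z) = (\<integral>\<^sup>+x. ?d x * u x \<partial>lebesgue_Rn n)"
    if "u \<in> borel_measurable (lebesgue_Rn n)" for u :: "(nat \<Rightarrow> real) \<Rightarrow> ennreal"
    unfolding gibbs_law_def using that by (intro nn_integral_density) auto
  have "(\<integral>\<^sup>+x. ?d x * ennreal (exp (a x)) \<partial>lebesgue_Rn n) * (\<integral>\<^sup>+x. ?d x * ennreal (exp (b x)) \<partial>lebesgue_Rn n)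
    \<le> (\<integral>\<^sup>+x. ?d x \<partial>lebesgue_Rn n)\<^sup>2"
    unfolding lebesgue_Rn_def
  proof (rule prekopa_leindler)
    fix x y :: "nat \<Rightarrow> real" assume "x \<in> {..<n} \<rightarrow>\<^sub>E UNIV" "y \<in> {..<n} \<rightarrow>\<^sub>E UNIV"
    then have xy: "x \<in> Rn n" "y \<in> Rn n" by (auto simp: Rn_def)
    let ?m = "\<lambda>i\<in>{..<n}. (x i + y i) / 2"
    have "(- V x + a x) + (- V y + b y) \<le> - V ?m + - V ?m"
      using midpoint_strongly_convex[OF C2 hess xy] ab[OF xy] by argo
    then have "exp ((- V x + a x) + (- V y + b y)) \<le> exp (- V ?m + - V ?m)" by simp
    then have "exp (- V x) * exp (a x) * (exp (- V y) * exp (b y)) \<le> exp (- V ?m) * exp (- V ?m)"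
      by (simp only: exp_add)
    then have "exp (- V x) * exp (a x) * (exp (- V y) * exp (b y)) / (Z * Z) \<le> exp (- V ?m) * exp (- V ?m) / (Z * Z)"
      by (rule divide_right_mono) simp
    then have "(exp (- V x) / Z * exp (a x)) * (exp (- V y) / Z * exp (b y)) \<le> (exp (- V ?m) / Z)\<^sup>2"
      by (simp add: power2_eq_square mult_ac)
    then have "ennreal ((exp (- V x) / Z * exp (a x)) * (exp (- V y) / Z * exp (b y))) \<le> ennreal ((exp (- V ?m) / Z)\<^sup>2)"
      by (rule ennreal_leI)
    moreover have "?d x * ennreal (exp (a x)) * (?d y * ennreal (exp (b y)))
      = ennreal ((exp (- V x) / Z * exp (a x)) * (exp (- V y) / Z * exp (b y)))"
      using Z by (subst ennreal_mult, simp, simp)+ simp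
    moreover have "(?d ?m)\<^sup>2 = ennreal ((exp (- V ?m) / Z)\<^sup>2)"
      using Z by (simp add: ennreal_power)
    ultimately show "?d x * ennreal (exp (a x)) * (?d y * ennreal (exp (b y))) \<le> (?d ?m)\<^sup>2"
      by simp
  qed (use assms(5,6) V in \<open>auto simp: lebesgue_Rn_def[symmetric]\<close>)
  also have "(\<integral>\<^sup>+x. ?d x \<partial>lebesgue_Rn n) = 1"
    using prob_space.emeasure_space_1[OF prob] dens[of "\<lambda>_. 1"] by simp
  finally show ?thesis by (simp add: dens)
qed

text \<open>Jensen by the tangent line of \<open>exp\<close> at the mean. The right side may be
  infinite, so only \<open>h\<close> has to be integrable.\<close>

lemma (in prob_space) exp_integral_le_nn_integral_exp:
  fixes h :: "'a \<Rightarrow> real"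
  assumes h: "integrable M h"
  shows "ennreal (exp (integral\<^sup>L M h)) \<le> (\<integral>\<^sup>+x. ennreal (exp (h x)) \<partial>M)"
proof (cases "(\<integral>\<^sup>+x. ennreal (exp (h x)) \<partial>M) = \<infinity>")
  case False
  have [measurable]: "h \<in> borel_measurable M" using h by simp
  let ?m = "integral\<^sup>L M h"
  have int: "integrable M (\<lambda>x. exp (h x))"
    using False by (intro integrableI_nonneg) (auto simp: less_top)
  have "exp ?m = (\<integral>x. exp ?m * (1 + (h x - ?m)) \<partial>M)"
    using h by (simp add: prob_space)
  also have "\<dots> \<le> (\<integral>x. exp (h x) \<partial>M)"
  proof (rule integral_mono[OF _ int])
    fix x
    have "exp ?m * (1 + (h x - ?m)) \<le> exp ?m * exp (h x - ?m)"
      by (intro mult_left_mono exp_ge_add_one_self) auto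
    then show "exp ?m * (1 + (h x - ?m)) \<le> exp (h x)" by (simp add: exp_add[symmetric])
  qed (use h in auto)
  finally show ?thesis
    using nn_integral_eq_integral[OF int] by (simp add: ennreal_leI)
qed simp

text \<open>Cauchy-Schwarz over pairs of indices. The Frobenius norm stands in for the operator
  norm, which is harmless because the variance bound is of the order of the squared Frobenius norm
  anyway.\<close>

lemma quadratic_form_square_le:
  fixes A :: "nat \<Rightarrow> nat \<Rightarrow> real"
  shows "(\<Sum>i<n. \<Sum>j<n. A i j * d i * d j)\<^sup>2 \<le> (\<Sum>i<n. \<Sum>j<n. (A i j)\<^sup>2) * (\<Sum>i<n. (d i)\<^sup>2)\<^sup>2"
proof -
  have "(\<Sum>(i,j)\<in>{..<n}\<times>{..<n}. A i j * (d i * d j))\<^sup>2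
    \<le> (\<Sum>(i,j)\<in>{..<n}\<times>{..<n}. (A i j)\<^sup>2) * (\<Sum>(i,j)\<in>{..<n}\<times>{..<n}. (d i * d j)\<^sup>2)"
    using Cauchy_Schwarz_ineq_sum[of "\<lambda>p. A (fst p) (snd p)" "\<lambda>p. d (fst p) * d (snd p)" "{..<n}\<times>{..<n}"]
    by (simp add: case_prod_unfold)
  moreover have "(\<Sum>i<n. \<Sum>j<n. (d i * d j)\<^sup>2) = (\<Sum>i<n. (d i)\<^sup>2)\<^sup>2"
    by (simp add: power2_eq_square[of "sum _ _"] sum_product power_mult_distrib)
  ultimately show ?thesis
    by (simp add: sum.cartesian_product[symmetric] mult.assoc)
qed

lemma exp_add_exp_minus_ge: "2 + u\<^sup>2 / 2 \<le> exp u + exp (- u)" for u :: real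
proof -
  have pos: "2 + u\<^sup>2 / 2 \<le> exp u + exp (- u)" if "0 \<le> u" for u :: real
    using exp_lower_Taylor_quadratic[OF that] exp_ge_add_one_self[of "- u"] by simp
  show ?thesis using pos[of u] pos[of "- u"] by (cases "0 \<le> u") auto
qed

section \<open>Isotropic strongly log-concave laws in a fixed dimension\<close>

locale gibbs_isotropic =
  fixes n :: nat and V :: "(nat \<Rightarrow> real) \<Rightarrow> real" and Z C :: real
  assumes C2: "C2_Rn n V" and hess: "hess_ge n V (1 / C)" and Cpos: "C > 0" and Z: "Z > 0"
    and prob: "prob_space (gibbs_law n V Z)"
    and int2: "\<And>i j. i < n \<Longrightarrow> j < n \<Longrightarrow> integrable (gibbs_law n V Z) (\<lambda>x. x i * x j)"
    and cov: "\<And>i j. i < n \<Longrightarrow> j < n \<Longrightarrow>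
                 (\<integral>x. x i * x j \<partial>gibbs_law n V Z) = (if i = j then 1 else 0)"
begin

abbreviation "\<mu> \<equiv> gibbs_law n V Z"

text \<open>\<open>h\<close> is a lower bound for the infimal convolution of \<open>t * g\<close>
  with \<open>1 / (4 * C)\<close> times the squared distance, so \<open>h\<close> and
  \<open>- (t * g)\<close> are an admissible pair for \<open>maurey_property\<close>. Jensen
  replaces the first factor by the exponential of the mean of \<open>h\<close>, and isotropy
  evaluates the means: \<open>g\<close> has mean \<open>T\<close>, and \<open>N\<close>, the squared
  norm of \<open>Ax\<close>, has mean \<open>F\<close>.\<close>

lemma quadratic_form_exp_bound:
  fixes A :: "nat \<Rightarrow> nat \<Rightarrow> real"
  defines "F \<equiv> \<Sum>i<n. \<Sum>j<n. (A i j)\<^sup>2"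
  assumes sym: "\<And>i j. A i j = A j i" and t: "t\<^sup>2 * F \<le> (1 / (8 * C))\<^sup>2"
  shows "(\<integral>\<^sup>+x. ennreal (exp (t * ((\<Sum>i<n. A i i) - (\<Sum>i<n. \<Sum>j<n. A i j * x i * x j)))) \<partial>\<mu>)
    \<le> ennreal (exp (8 * C * t\<^sup>2 * F))"
proof -
  interpret prob_space \<mu> by (rule prob)
  define g where "g x = (\<Sum>i<n. \<Sum>j<n. A i j * x i * x j)" for x
  define T where "T = (\<Sum>i<n. A i i)"
  define Ax where "Ax x i = (\<Sum>j<n. A i j * x j)" for x i
  define N where "N x = (\<Sum>i<n. (Ax x i)\<^sup>2)" for x
  define h where "h x = t * g x - 8 * C * t\<^sup>2 * N x" for x
  have [measurable]: "g \<in> borel_measurable (lebesgue_Rn n)"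
    unfolding g_def by (intro borel_measurable_sum borel_measurable_times measurable_coordinate_Rn) auto
  have [measurable]: "N \<in> borel_measurable (lebesgue_Rn n)"
    unfolding N_def Ax_def
    by (intro borel_measurable_sum borel_measurable_power borel_measurable_times measurable_coordinate_Rn) auto
  have le: "h x + - (t * g y) \<le> 1 / C / 4 * (\<Sum>i<n. (y i - x i)\<^sup>2)" for x y
  proof -
    define d where "d i = y i - x i" for i
    have y: "y i = x i + d i" for i by (simp add: d_def)
    have cross: "(\<Sum>i<n. \<Sum>j<n. A i j * x i * d j) = (\<Sum>i<n. d i * Ax x i)"
      by (subst sum.swap) (simp add: Ax_def sum_distrib_left sym mult_ac)
    have cross': "(\<Sum>i<n. \<Sum>j<n. A i j * d i * x j) = (\<Sum>i<n. d i * Ax x i)"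
      by (simp add: Ax_def sum_distrib_left mult_ac)
    have "g y = g x + (\<Sum>i<n. \<Sum>j<n. A i j * x i * d j) + (\<Sum>i<n. \<Sum>j<n. A i j * d i * x j) + g d"
      by (simp add: g_def y algebra_simps sum.distrib)
    then have gy: "g y = g x + 2 * (\<Sum>i<n. d i * Ax x i) + g d"
      using cross cross' by simp
    \<comment> \<open>One half of the cost, \<open>1 / (8 * C)\<close>, pays for the purely
      quadratic term \<open>t * g d\<close>; the bound on \<open>t\<close> is made for this.\<close>
    have "(t * g d)\<^sup>2 \<le> (1 / (8 * C))\<^sup>2 * (\<Sum>i<n. (d i)\<^sup>2)\<^sup>2"
    proof -
      have "(t * g d)\<^sup>2 \<le> t\<^sup>2 * (F * (\<Sum>i<n. (d i)\<^sup>2)\<^sup>2)"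
        unfolding power_mult_distrib g_def F_def by (intro mult_left_mono quadratic_form_square_le) auto
      also have "\<dots> = (t\<^sup>2 * F) * (\<Sum>i<n. (d i)\<^sup>2)\<^sup>2" by simp
      also have "\<dots> \<le> (1 / (8 * C))\<^sup>2 * (\<Sum>i<n. (d i)\<^sup>2)\<^sup>2"
        by (intro mult_right_mono t) auto
      finally show ?thesis .
    qed
    then have "(t * g d)\<^sup>2 \<le> (1 / (8 * C) * (\<Sum>i<n. (d i)\<^sup>2))\<^sup>2"
      by (simp only: power_mult_distrib)
    then have "\<bar>t * g d\<bar> \<le> 1 / (8 * C) * (\<Sum>i<n. (d i)\<^sup>2)"
      using Cpos by (subst (asm) abs_le_square_iff[symmetric]) (simp add: sum_nonneg)
    then have gd: "- (t * g d) \<le> 1 / (8 * C) * (\<Sum>i<n. (d i)\<^sup>2)" by linarith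
    \<comment> \<open>The other half pays for the cross term by completing the square, at the price
      \<open>8 * C * t\<^sup>2 * N x\<close> subtracted in \<open>h\<close>.\<close>
    have "- (2 * t * (d i * Ax x i)) \<le> 1 / (8 * C) * (d i)\<^sup>2 + 8 * C * t\<^sup>2 * (Ax x i)\<^sup>2" for i
    proof -
      have "0 \<le> 1 / (8 * C) * (d i + 8 * C * t * Ax x i)\<^sup>2" using Cpos by simp
      also have "\<dots> = 1 / (8 * C) * (d i)\<^sup>2 + 2 * t * (d i * Ax x i) + 8 * C * t\<^sup>2 * (Ax x i)\<^sup>2"
        using Cpos by (simp add: power2_eq_square field_simps)
      finally show ?thesis by simp
    qed
    then have "(\<Sum>i<n. - (2 * t * (d i * Ax x i))) \<le> (\<Sum>i<n. 1 / (8 * C) * (d i)\<^sup>2 + 8 * C * t\<^sup>2 * (Ax x i)\<^sup>2)"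
      by (intro sum_mono)
    then have "- (2 * t * (\<Sum>i<n. d i * Ax x i)) \<le> 1 / (8 * C) * (\<Sum>i<n. (d i)\<^sup>2) + 8 * C * t\<^sup>2 * N x"
      by (simp add: sum_negf sum.distrib sum_distrib_left N_def)
    with gd show ?thesis
      unfolding h_def gy d_def[symmetric] by (simp add: algebra_simps)
  qed
  have "(\<integral>\<^sup>+x. ennreal (exp (h x)) \<partial>\<mu>) * (\<integral>\<^sup>+x. ennreal (exp (- (t * g x))) \<partial>\<mu>) \<le> 1"
    by (rule maurey_property[OF C2 hess Z prob]) (use le in \<open>auto simp: h_def\<close>)
  moreover have "integrable \<mu> g" "integral\<^sup>L \<mu> g = T"
  proof -
    have "integrable \<mu> (\<lambda>x. A i j * x i * x j)" if "i < n" "j < n" for i j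
      using int2[OF that] by (simp add: mult.assoc)
    then show "integrable \<mu> g" unfolding g_def by (intro Bochner_Integration.integrable_sum) auto
    have "integral\<^sup>L \<mu> g = (\<Sum>i<n. \<Sum>j<n. A i j * (\<integral>x. x i * x j \<partial>\<mu>))"
      unfolding g_def mult.assoc
      by (subst Bochner_Integration.integral_sum, (auto intro!: Bochner_Integration.integrable_sum int2 integrable_mult_right)[1],
          intro sum.cong refl, subst Bochner_Integration.integral_sum)
         (auto intro!: int2)
    also have "\<dots> = (\<Sum>i<n. \<Sum>j<n. if j = i then A i j else 0)"
      by (intro sum.cong refl) (auto simp: cov)
    also have "\<dots> = T" by (simp add: T_def)
    finally show "integral\<^sup>L \<mu> g = T" .
  qed
  moreover have "integrable \<mu> N" "integral\<^sup>L \<mu> N = F"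
  proof -
    have N: "N x = (\<Sum>i<n. \<Sum>j<n. \<Sum>k<n. A i j * A i k * (x j * x k))" for x
      by (simp add: N_def Ax_def power2_eq_square sum_product mult_ac)
    have "integrable \<mu> (\<lambda>x. A i j * A i k * (x j * x k))" if "j < n" "k < n" for i j k
      using int2[OF that] by simp
    then show "integrable \<mu> N" unfolding N by (intro Bochner_Integration.integrable_sum) auto
    have "integral\<^sup>L \<mu> N = (\<Sum>i<n. \<Sum>j<n. \<Sum>k<n. A i j * A i k * (\<integral>x. x j * x k \<partial>\<mu>))"
      unfolding N
      by (subst Bochner_Integration.integral_sum, (auto intro!: Bochner_Integration.integrable_sum int2 integrable_mult_right)[1],
          intro sum.cong refl, subst Bochner_Integration.integral_sum,
          (auto intro!: Bochner_Integration.integrable_sum int2 integrable_mult_right)[1],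
          intro sum.cong refl, subst Bochner_Integration.integral_sum)
         (auto intro!: int2)
    also have "\<dots> = (\<Sum>i<n. \<Sum>j<n. \<Sum>k<n. if k = j then A i j * A i k else 0)"
      by (intro sum.cong refl) (auto simp: cov)
    also have "\<dots> = F" by (simp add: F_def power2_eq_square)
    finally show "integral\<^sup>L \<mu> N = F" .
  qed
  ultimately have int: "integrable \<mu> h" "integral\<^sup>L \<mu> h = t * T - 8 * C * t\<^sup>2 * F"
    and prod: "(\<integral>\<^sup>+x. ennreal (exp (h x)) \<partial>\<mu>) * (\<integral>\<^sup>+x. ennreal (exp (- (t * g x))) \<partial>\<mu>) \<le> 1"
    unfolding h_def by auto
  let ?m = "t * T - 8 * C * t\<^sup>2 * F" and ?I = "\<integral>\<^sup>+x. ennreal (exp (- (t * g x))) \<partial>\<mu>"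
  have "ennreal (exp ?m) * ?I \<le> 1"
    using exp_integral_le_nn_integral_exp[OF int(1)] prod unfolding int(2)
    by (meson mult_right_mono order_trans zero_le)
  then have le1: "ennreal (exp (8 * C * t\<^sup>2 * F)) * (ennreal (exp ?m) * ?I) \<le> ennreal (exp (8 * C * t\<^sup>2 * F)) * 1"
    by (rule mult_left_mono) simp
  have "(\<integral>\<^sup>+x. ennreal (exp (t * (T - g x))) \<partial>\<mu>) = (\<integral>\<^sup>+x. ennreal (exp (t * T)) * ennreal (exp (- (t * g x))) \<partial>\<mu>)"
    by (simp add: ennreal_mult[symmetric] exp_add[symmetric] algebra_simps)
  also have "\<dots> = ennreal (exp (t * T)) * ?I"
    by (rule nn_integral_cmult) measurable
  also have "\<dots> = ennreal (exp (8 * C * t\<^sup>2 * F)) * (ennreal (exp ?m) * ?I)"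
    by (simp add: mult.assoc[symmetric] ennreal_mult[symmetric] exp_add[symmetric])
  finally show ?thesis using le1 by (simp add: T_def g_def)
qed

text \<open>The exponential bounds at \<open>t\<close> and \<open>- t\<close> are added, and
  \<open>exp_add_exp_minus_ge\<close> extracts the second moment. As these bounds exceed 1 only by a
  multiple of \<open>t\<^sup>2 * F\<close>, dividing by \<open>t\<^sup>2\<close> leaves a multiple
  of \<open>F\<close>.\<close>

lemma quadratic_form_variance:
  fixes A :: "nat \<Rightarrow> nat \<Rightarrow> real"
  assumes sym: "\<And>i j. A i j = A j i"
  shows "(\<integral>\<^sup>+x. ennreal (((\<Sum>i<n. \<Sum>j<n. A i j * x i * x j) - (\<Sum>i<n. A i i))\<^sup>2) \<partial>\<mu>)
    \<le> ennreal (64 * C * (\<Sum>i<n. \<Sum>j<n. (A i j)\<^sup>2))"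
proof -
  interpret prob_space \<mu> by (rule prob)
  define F where "F = (\<Sum>i<n. \<Sum>j<n. (A i j)\<^sup>2)"
  define q where "q x = (\<Sum>i<n. \<Sum>j<n. A i j * x i * x j) - (\<Sum>i<n. A i i)" for x
  have F: "F \<ge> 0" by (simp add: F_def sum_nonneg)
  \<comment> \<open>Of size \<open>1 / sqrt F\<close>, the largest scale that the exponential bound
    allows. The 1 next to \<open>sqrt F\<close> covers \<open>F = 0\<close>; the 1 next to
    \<open>8 * C\<close> makes \<open>w \<le> 1\<close> also for small \<open>C\<close>.\<close>
  define t where "t = 1 / ((8 * C + 1) * (1 + sqrt F))"
  define w where "w = 8 * C * t\<^sup>2 * F"
  have t: "t > 0" using F Cpos by (simp add: t_def add_nonneg_pos add_pos_nonneg)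
  have "t * sqrt F = 1 / (8 * C + 1) * (sqrt F / (1 + sqrt F))"
    by (simp add: t_def)
  also have "\<dots> \<le> 1 / (8 * C + 1) * 1"
    using F Cpos by (intro mult_left_mono) (auto simp: divide_le_eq add_pos_nonneg)
  finally have ts: "t * sqrt F \<le> 1 / (8 * C + 1)" by simp
  have ts0: "0 \<le> t * sqrt F" using t F by simp
  have tF: "t\<^sup>2 * F \<le> (1 / (8 * C + 1))\<^sup>2"
    using power_mono[OF ts ts0, of 2] F by (simp add: power_mult_distrib)
  also have "\<dots> \<le> (1 / (8 * C))\<^sup>2"
    using Cpos by (intro power_mono divide_left_mono) auto
  finally have tF8: "t\<^sup>2 * F \<le> (1 / (8 * C))\<^sup>2" .
  have w0: "0 \<le> w" using Cpos F by (simp add: w_def)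
  have "w \<le> 8 * C * (1 / (8 * C + 1))\<^sup>2"
    unfolding w_def mult.assoc using tF Cpos by (intro mult_left_mono) auto
  also have "\<dots> \<le> 1"
    using Cpos by (simp add: power_divide divide_le_eq) (simp add: power2_eq_square algebra_simps)
  finally have w1: "w \<le> 1" .
  have [measurable]: "q \<in> borel_measurable (lebesgue_Rn n)"
    unfolding q_def
    by (intro borel_measurable_diff borel_measurable_sum borel_measurable_times measurable_coordinate_Rn) auto
  have e1: "(\<integral>\<^sup>+x. ennreal (exp (- (t * q x))) \<partial>\<mu>) \<le> ennreal (exp w)"
    using quadratic_form_exp_bound[of A t, OF sym] tF8
    by (simp add: F_def w_def q_def right_diff_distrib)
  have e2: "(\<integral>\<^sup>+x. ennreal (exp (t * q x)) \<partial>\<mu>) \<le> ennreal (exp w)"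
    using quadratic_form_exp_bound[of A "- t", OF sym] tF8
    by (simp add: F_def w_def q_def right_diff_distrib)
  have "ennreal (t\<^sup>2 / 2) * (\<integral>\<^sup>+x. ennreal ((q x)\<^sup>2) \<partial>\<mu>) + 2
    = (\<integral>\<^sup>+x. ennreal (t\<^sup>2 / 2) * ennreal ((q x)\<^sup>2) + 2 \<partial>\<mu>)"
    by (subst nn_integral_add) (auto simp: nn_integral_cmult emeasure_space_1)
  also have "\<dots> \<le> (\<integral>\<^sup>+x. ennreal (exp (t * q x)) + ennreal (exp (- (t * q x))) \<partial>\<mu>)"
  proof (rule nn_integral_mono)
    fix x
    have "ennreal (t\<^sup>2 / 2) * ennreal ((q x)\<^sup>2) + 2 = ennreal (2 + (t * q x)\<^sup>2 / 2)"
      by (simp add: ennreal_mult[symmetric] ennreal_plus[symmetric] ennreal_numeral[symmetric]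
        power_mult_distrib add.commute del: ennreal_plus ennreal_numeral)
    also have "\<dots> \<le> ennreal (exp (t * q x) + exp (- (t * q x)))"
      by (intro ennreal_leI exp_add_exp_minus_ge)
    finally show "ennreal (t\<^sup>2 / 2) * ennreal ((q x)\<^sup>2) + 2 \<le> ennreal (exp (t * q x)) + ennreal (exp (- (t * q x)))"
      by simp
  qed
  also have "\<dots> = (\<integral>\<^sup>+x. ennreal (exp (t * q x)) \<partial>\<mu>) + (\<integral>\<^sup>+x. ennreal (exp (- (t * q x))) \<partial>\<mu>)"
    by (rule nn_integral_add) auto
  also have "\<dots> \<le> ennreal (exp w) + ennreal (exp w)"
    by (intro add_mono e1 e2)
  also have "\<dots> = ennreal (2 * exp w)" by (simp add: ennreal_plus[symmetric] del: ennreal_plus)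
  \<comment> \<open>On the unit interval \<open>exp w\<close> is at most \<open>1 + 2 * w\<close>.
    The factor 64 is then \<open>2 * 4 * 8\<close>, from \<open>2 / t\<^sup>2\<close> times
    \<open>4 * w\<close>.\<close>
  also have "\<dots> \<le> ennreal (4 * w + 2)"
  proof (rule ennreal_leI)
    have "exp w \<le> 1 + w + w\<^sup>2" by (rule exp_bound[OF w0 w1])
    moreover have "w\<^sup>2 \<le> w" using w0 w1 by (simp add: power2_eq_square mult_left_le)
    ultimately show "2 * exp w \<le> 4 * w + 2" by simp
  qed
  also have "\<dots> = ennreal (4 * w) + 2"
    using w0 by (simp add: ennreal_numeral[symmetric] del: ennreal_numeral)
  finally have "ennreal (t\<^sup>2 / 2) * (\<integral>\<^sup>+x. ennreal ((q x)\<^sup>2) \<partial>\<mu>) \<le> ennreal (4 * w)"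
    by (simp add: ennreal_add_left_cancel_le add.commute[of _ 2])
  then have "ennreal (2 / t\<^sup>2) * (ennreal (t\<^sup>2 / 2) * (\<integral>\<^sup>+x. ennreal ((q x)\<^sup>2) \<partial>\<mu>)) \<le> ennreal (2 / t\<^sup>2) * ennreal (4 * w)"
    by (rule mult_left_mono) simp
  moreover have "ennreal (2 / t\<^sup>2) * (ennreal (t\<^sup>2 / 2) * X) = X" for X
    using t by (simp add: mult.assoc[symmetric] ennreal_mult[symmetric])
  moreover have "ennreal (2 / t\<^sup>2) * ennreal (4 * w) = ennreal (64 * C * F)"
    using t w0 by (simp add: ennreal_mult[symmetric] w_def mult_ac)
  ultimately show ?thesis by (simp add: F_def q_def)
qed

end

section \<open>Resolvents of sample covariance matrices\<close>

definition bilin :: "nat \<Rightarrow> (nat \<Rightarrow> nat \<Rightarrow> complex) \<Rightarrow> (nat \<Rightarrow> real) \<Rightarrow> complex" where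
  "bilin n B y = (\<Sum>i<n. of_real (y i) * (\<Sum>k<n. B i k * of_real (y k)))"

definition trc :: "nat \<Rightarrow> (nat \<Rightarrow> nat \<Rightarrow> complex) \<Rightarrow> complex" where
  "trc n B = (\<Sum>i<n. B i i)"

definition gram :: "complex \<Rightarrow> (nat \<Rightarrow> real) list \<Rightarrow> nat \<Rightarrow> nat \<Rightarrow> complex" where
  "gram z ys i k = (\<Sum>y\<leftarrow>ys. of_real (y i) * of_real (y k)) / z - (if i = k then z else 0)"

text \<open>The Sherman-Morrison update taken as the definition: symmetry and measurability in the
  columns follow by induction on the list, and \<open>resolvent_inverse\<close> shows afterwards
  that this is the inverse of \<open>gram\<close>. By symmetry, row \<open>k\<close> replaces column
  \<open>k\<close> in the second factor.\<close>

primrec resolvent :: "nat \<Rightarrow> complex \<Rightarrow> (nat \<Rightarrow> real) list \<Rightarrow> nat \<Rightarrow> nat \<Rightarrow> complex" where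
  "resolvent n z [] = (\<lambda>i k. if i = k then - 1 / z else 0)"
| "resolvent n z (y # ys) = (\<lambda>i k. resolvent n z ys i k -
     (\<Sum>l<n. resolvent n z ys i l * of_real (y l)) * (\<Sum>l<n. resolvent n z ys k l * of_real (y l))
     / (z + bilin n (resolvent n z ys) y))"

lemma gram_Cons: "gram z (y # ys) i k = of_real (y i) * of_real (y k) / z + gram z ys i k"
  by (simp add: gram_def add_divide_distrib)

lemma resolvent_sym: "resolvent n z ys i k = resolvent n z ys k i"
  by (induction ys arbitrary: i k) (simp_all add: mult.commute)

lemma gram_sym: "gram z ys i k = gram z ys k i"
  by (simp add: gram_def mult.commute)

lemma of_real_cmod_square: "(complex_of_real (cmod x))\<^sup>2 = x * cnj x"
  by (metis complex_norm_square of_real_power)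

text \<open>\<open>P\<close> is the squared norm of \<open>Y^T b\<close>, and only its sign matters:
  \<open>1 / z\<close> and \<open>- z\<close> both have imaginary parts of the sign opposite to
  \<open>Im z\<close>.\<close>

lemma gram_hermitian_form:
  "\<exists>P\<ge>0. (\<Sum>i<n. \<Sum>k<n. cnj (b i) * (gram z ys i k * b k)) =
     of_real P / z - z * of_real (\<Sum>i<n. (cmod (b i))\<^sup>2)"
proof (induction ys)
  case Nil
  have "(\<Sum>i<n. \<Sum>k<n. cnj (b i) * (gram z [] i k * b k)) = (\<Sum>i<n. \<Sum>k<n. if k = i then - z * (cnj (b i) * b i) else 0)"
    by (intro sum.cong refl) (simp add: gram_def)
  also have "\<dots> = - z * of_real (\<Sum>i<n. (cmod (b i))\<^sup>2)"
    by (simp add: of_real_cmod_square sum_distrib_left mult.commute[of "cnj _"] sum_negf)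
  finally show ?case by (intro exI[of _ 0]) simp
next
  case (Cons y ys)
  then obtain P where P: "P \<ge> 0" "(\<Sum>i<n. \<Sum>k<n. cnj (b i) * (gram z ys i k * b k)) =
     of_real P / z - z * of_real (\<Sum>i<n. (cmod (b i))\<^sup>2)" by blast
  define u where "u = (\<Sum>k<n. of_real (y k) * b k)"
  have "(\<Sum>i<n. \<Sum>k<n. cnj (b i) * (of_real (y i) * of_real (y k) / z * b k)) = cnj u * u / z"
    unfolding u_def cnj_sum sum_product sum_divide_distrib by (intro sum.cong refl) (simp add: mult_ac)
  also have "\<dots> = of_real ((cmod u)\<^sup>2) / z" by (simp add: of_real_cmod_square mult.commute)
  finally have "(\<Sum>i<n. \<Sum>k<n. cnj (b i) * (gram z (y # ys) i k * b k)) =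
     of_real (P + (cmod u)\<^sup>2) / z - z * of_real (\<Sum>i<n. (cmod (b i))\<^sup>2)"
    unfolding gram_Cons distrib_right distrib_left sum.distrib P(2)
    by (simp add: add_divide_distrib)
  with P(1) show ?case by (intro exI[of _ "P + (cmod u)\<^sup>2"]) auto
qed

text \<open>With \<open>b = B y\<close> and \<open>y\<close> real, \<open>bilin n B y\<close> is the
  conjugate of the Hermitian form of \<open>gram\<close> at \<open>b\<close>. It is stated for an
  arbitrary right inverse \<open>B\<close> because it is needed inside the induction that proves
  \<open>resolvent\<close> to be one.\<close>

lemma bilin_inverse_Im:
  assumes inv: "\<And>i l. i < n \<Longrightarrow> l < n \<Longrightarrow> (\<Sum>k<n. gram z ys i k * B k l) = (if i = l then 1 else 0)"
  shows "(Im z)\<^sup>2 * (\<Sum>i<n. (cmod (\<Sum>k<n. B i k * of_real (y k)))\<^sup>2) \<le> Im (bilin n B y) * Im z"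
proof -
  define b where "b i = (\<Sum>k<n. B i k * of_real (y k))" for i
  define N where "N = (\<Sum>i<n. (cmod (b i))\<^sup>2)"
  obtain P where P: "P \<ge> 0" "(\<Sum>i<n. \<Sum>k<n. cnj (b i) * (gram z ys i k * b k)) = of_real P / z - z * of_real N"
    unfolding N_def using gram_hermitian_form by blast
  have Mb: "(\<Sum>k<n. gram z ys i k * b k) = of_real (y i)" if "i < n" for i
  proof -
    have "(\<Sum>k<n. gram z ys i k * b k) = (\<Sum>l<n. (\<Sum>k<n. gram z ys i k * B k l) * of_real (y l))"
      unfolding b_def sum_distrib_left sum_distrib_right by (subst sum.swap) (simp add: mult_ac)
    also have "\<dots> = (\<Sum>l<n. if l = i then of_real (y l) else 0)"
      by (intro sum.cong refl) (use that in \<open>auto simp: inv\<close>)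
    finally show ?thesis using that by simp
  qed
  have "bilin n B y = cnj (\<Sum>i<n. cnj (b i) * of_real (y i))"
    by (simp add: bilin_def b_def cnj_sum mult.commute)
  also have "(\<Sum>i<n. cnj (b i) * of_real (y i)) = of_real P / z - z * of_real N"
    by (simp add: P(2)[symmetric] sum_distrib_left[symmetric] Mb)
  finally have "Im (bilin n B y) = P * Im z / (cmod z)\<^sup>2 + N * Im z"
    by (simp add: Im_divide cmod_power2)
  then have "Im (bilin n B y) * Im z = P * (Im z)\<^sup>2 / (cmod z)\<^sup>2 + (Im z)\<^sup>2 * N"
    by (simp add: algebra_simps power2_eq_square)
  with P(1) show ?thesis by (simp add: N_def b_def)
qed

text \<open>The imaginary parts of \<open>z\<close> and \<open>q\<close> cannot cancel. The summand
  \<open>N\<close> is kept because it later dominates a numerator of size \<open>N\<close> in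
  \<open>trc_resolvent_Cons\<close>.\<close>

lemma cmod_add_ge_of_Im:
  assumes z: "Im z \<noteq> 0" and N: "(Im z)\<^sup>2 * N \<le> Im q * Im z"
  shows "\<bar>Im z\<bar> * (1 + N) \<le> cmod (z + q)"
proof -
  have "\<bar>Im z\<bar> * (\<bar>Im z\<bar> * (1 + N)) = (\<bar>Im z\<bar> * \<bar>Im z\<bar>) * (1 + N)" by simp
  also have "\<dots> = (Im z)\<^sup>2 + (Im z)\<^sup>2 * N"
    by (simp add: power2_eq_square distrib_left)
  also have "\<dots> \<le> Im (z + q) * Im z" using N by (simp add: power2_eq_square algebra_simps)
  also have "\<dots> \<le> \<bar>Im z\<bar> * cmod (z + q)"
  proof -
    have "Im (z + q) * Im z \<le> \<bar>Im z\<bar> * \<bar>Im (z + q)\<bar>"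
      using abs_ge_self[of "Im (z + q) * Im z"] by (simp add: abs_mult mult.commute)
    also have "\<dots> \<le> \<bar>Im z\<bar> * cmod (z + q)"
      by (intro mult_left_mono abs_Im_le_cmod) auto
    finally show ?thesis .
  qed
  finally show ?thesis using z by (simp add: mult_le_cancel_left)
qed

text \<open>Sherman-Morrison by induction. The induction hypothesis also yields the imaginary-part
  bound for the shorter list, which keeps the denominator \<open>z + q\<close> away from 0.\<close>

lemma resolvent_inverse:
  assumes z: "Im z \<noteq> 0"
  shows "i < n \<Longrightarrow> l < n \<Longrightarrow> (\<Sum>k<n. gram z ys i k * resolvent n z ys k l) = (if i = l then 1 else 0)"
proof (induction ys arbitrary: i l)
  case Nil
  have "z \<noteq> 0" using z by auto
  have "(\<Sum>k<n. gram z [] i k * resolvent n z [] k l) = (\<Sum>k<n. if k = i then (if i = l then 1 else 0) else 0)"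
    using \<open>z \<noteq> 0\<close> by (intro sum.cong refl) (auto simp: gram_def)
  then show ?case using Nil by simp
next
  case (Cons y ys)
  define B where "B = resolvent n z ys"
  define b where "b i = (\<Sum>l<n. B i l * of_real (y l))" for i
  define q where "q = bilin n B y"
  have z0: "z \<noteq> 0" using z by auto
  have "(Im z)\<^sup>2 * (\<Sum>i<n. (cmod (b i))\<^sup>2) \<le> Im q * Im z"
    unfolding b_def q_def by (rule bilin_inverse_Im[where ys = ys]) (simp add: B_def Cons.IH)
  from cmod_add_ge_of_Im[OF z this] have "cmod (z + q) > 0"
    using z by (smt (verit, best) mult_pos_pos sum_nonneg zero_le_power2)
  then have zq: "z + q \<noteq> 0" by auto
  have Mb: "(\<Sum>k<n. gram z ys i k * b k) = of_real (y i)"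
  proof -
    have "(\<Sum>k<n. gram z ys i k * b k) = (\<Sum>l<n. (\<Sum>k<n. gram z ys i k * B k l) * of_real (y l))"
      unfolding b_def sum_distrib_left sum_distrib_right by (subst sum.swap) (simp add: mult_ac)
    also have "\<dots> = (\<Sum>l<n. if l = i then of_real (y l) else 0)"
      by (intro sum.cong refl) (use Cons in \<open>auto simp: B_def\<close>)
    finally show ?thesis using Cons.prems by simp
  qed
  have yB: "(\<Sum>k<n. of_real (y k) * B k l) = b l"
    by (simp add: b_def B_def resolvent_sym[of n z ys l] mult.commute)
  have yb: "(\<Sum>k<n. of_real (y k) * b k) = q" by (simp add: q_def bilin_def b_def)
  have "(\<Sum>k<n. gram z (y # ys) i k * resolvent n z (y # ys) k l)
    = (\<Sum>k<n. (of_real (y i) * of_real (y k) / z + gram z ys i k) * (B k l - b k * b l / (z + q)))"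
    by (simp add: gram_Cons B_def b_def q_def)
  also have "\<dots> = of_real (y i) / z * (\<Sum>k<n. of_real (y k) * B k l) + (\<Sum>k<n. gram z ys i k * B k l)
     - of_real (y i) / z * (b l / (z + q)) * (\<Sum>k<n. of_real (y k) * b k) - b l / (z + q) * (\<Sum>k<n. gram z ys i k * b k)"
    unfolding sum_distrib_left sum.distrib[symmetric] sum_subtractf[symmetric]
    by (intro sum.cong refl) (simp add: algebra_simps)
  also have "\<dots> = of_real (y i) / z * b l + (if i = l then 1 else 0)
     - of_real (y i) / z * (b l / (z + q)) * q - b l / (z + q) * of_real (y i)"
    unfolding yB yb Mb using Cons by (simp add: B_def)
  also have "\<dots> = (if i = l then 1 else 0)"
  proof -
    have "a / z * x + e - a / z * (x / d) * (d - z) - x / d * a = e" if "d \<noteq> 0" for a x e d :: complex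
      using z0 that by (simp add: field_simps)
    from this[OF zq, of "of_real (y i)" "b l"] show ?thesis by simp
  qed
  finally show ?case .
qed

lemma resolvent_bilin_Im:
  assumes "Im z \<noteq> 0"
  shows "(Im z)\<^sup>2 * (\<Sum>i<n. (cmod (\<Sum>k<n. resolvent n z ys i k * of_real (y k)))\<^sup>2)
    \<le> Im (bilin n (resolvent n z ys) y) * Im z"
  by (rule bilin_inverse_Im) (rule resolvent_inverse[OF assms])

lemma cmod_add_bilin_ge:
  assumes z: "Im z \<noteq> 0"
  shows "\<bar>Im z\<bar> * (1 + (\<Sum>i<n. (cmod (\<Sum>k<n. resolvent n z ys i k * of_real (y k)))\<^sup>2))
    \<le> cmod (z + bilin n (resolvent n z ys) y)"
  by (rule cmod_add_ge_of_Im[OF z resolvent_bilin_Im[OF z]])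

lemma cmod_add_bilin_ge_Im:
  assumes z: "Im z \<noteq> 0"
  shows "\<bar>Im z\<bar> \<le> cmod (z + bilin n (resolvent n z ys) y)"
proof -
  have "\<bar>Im z\<bar> * 1 \<le> \<bar>Im z\<bar> * (1 + (\<Sum>i<n. (cmod (\<Sum>k<n. resolvent n z ys i k * of_real (y k)))\<^sup>2))"
    by (intro mult_left_mono) (auto intro: sum_nonneg)
  with cmod_add_bilin_ge[OF z, of n ys y] show ?thesis by linarith
qed

text \<open>The imaginary-part bound, tested on the unit vector \<open>e_l\<close>, improves itself:
  a diagonal entry is at most the norm of its column, so \<open>x = |Im z| * sqrt S\<close> with
  \<open>S\<close> the squared column norm satisfies \<open>x * x <= x\<close>, hence
  \<open>x <= 1\<close>.\<close>

lemma
  assumes z: "Im z \<noteq> 0" and l: "l < n"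
  shows resolvent_column_norm: "(\<Sum>i<n. (cmod (resolvent n z ys i l))\<^sup>2) \<le> 1 / (Im z)\<^sup>2"
    and resolvent_diag_Im: "0 \<le> Im (resolvent n z ys l l) * Im z"
    and resolvent_diag_norm: "cmod (resolvent n z ys l l) \<le> 1 / \<bar>Im z\<bar>"
proof -
  let ?B = "resolvent n z ys" and ?e = "\<lambda>k. if k = l then 1 else (0::real)"
  let ?S = "\<Sum>i<n. (cmod (?B i l))\<^sup>2"
  have e: "(\<Sum>k<n. ?B i k * of_real (?e k)) = ?B i l" for i
    using l by (simp add: if_distrib[of of_real] if_distrib[of "(*) _"] cong: if_cong)
  have "bilin n ?B ?e = (\<Sum>i<n. if i = l then ?B l l else 0)"
    unfolding bilin_def e by (intro sum.cong refl) auto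
  then have b: "bilin n ?B ?e = ?B l l" using l by simp
  have S: "(Im z)\<^sup>2 * ?S \<le> Im (?B l l) * Im z"
    using resolvent_bilin_Im[OF z, of n ys ?e] unfolding e b .
  have S0: "0 \<le> ?S" by (intro sum_nonneg) auto
  then show "0 \<le> Im (?B l l) * Im z" using S by (smt (verit) mult_nonneg_nonneg zero_le_power2)
  have BS: "(cmod (?B l l))\<^sup>2 \<le> ?S"
    using l by (intro member_le_sum[of l "{..<n}" "\<lambda>i. (cmod (?B i l))\<^sup>2"]) auto
  define x where "x = \<bar>Im z\<bar> * sqrt ?S"
  have "x * x = (Im z)\<^sup>2 * ?S" 
    using S0 unfolding x_def power2_eq_square[symmetric] power_mult_distrib by simp
  also have "\<dots> \<le> \<bar>Im (?B l l)\<bar> * \<bar>Im z\<bar>" 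
    using S abs_ge_self[of "Im (?B l l) * Im z"] by (simp add: abs_mult)
  also have "\<dots> \<le> sqrt ?S * \<bar>Im z\<bar>"
    using abs_Im_le_cmod[of "?B l l"] real_le_rsqrt[OF BS] by (intro mult_right_mono) auto
  finally have "x * x \<le> x" by (simp add: x_def mult.commute)
  moreover have "0 \<le> x" using S0 by (simp add: x_def)
  ultimately have x1: "x \<le> 1"
    by (cases "x = 0") (auto simp: mult_le_cancel_left1)
  then have "x\<^sup>2 \<le> 1" using \<open>0 \<le> x\<close> by (simp add: power_le_one)
  then show "?S \<le> 1 / (Im z)\<^sup>2"
    using z S0 by (simp add: x_def power_mult_distrib field_simps)
  have "\<bar>Im z\<bar> * cmod (?B l l) \<le> x"
    unfolding x_def using real_le_rsqrt[OF BS] by (intro mult_left_mono) auto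
  then show "cmod (?B l l) \<le> 1 / \<bar>Im z\<bar>" using x1 z by (simp add: field_simps)
qed

lemma resolvent_frobenius:
  assumes z: "Im z \<noteq> 0"
  shows "(\<Sum>i<n. \<Sum>l<n. (cmod (resolvent n z ys i l))\<^sup>2) \<le> real n / (Im z)\<^sup>2"
proof -
  have "(\<Sum>i<n. \<Sum>l<n. (cmod (resolvent n z ys i l))\<^sup>2) = (\<Sum>l<n. \<Sum>i<n. (cmod (resolvent n z ys i l))\<^sup>2)"
    by (rule sum.swap)
  also have "\<dots> \<le> (\<Sum>l<n. 1 / (Im z)\<^sup>2)"
    by (intro sum_mono resolvent_column_norm[OF z]) auto
  finally show ?thesis by simp
qed

text \<open>A rank-one update changes the trace by a quotient with numerator at most
  \<open>N\<close> and denominator at least \<open>|Im z| * (1 + N)\<close>, hence by an amount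
  independent of \<open>n\<close> and of the size of \<open>y\<close>.\<close>

lemma trc_resolvent_Cons:
  assumes z: "Im z \<noteq> 0"
  shows "cmod (trc n (resolvent n z ys) - trc n (resolvent n z (y # ys))) \<le> 1 / \<bar>Im z\<bar>"
proof -
  define b where "b i = (\<Sum>k<n. resolvent n z ys i k * of_real (y k))" for i
  define N where "N = (\<Sum>i<n. (cmod (b i))\<^sup>2)"
  let ?d = "z + bilin n (resolvent n z ys) y"
  have N: "0 \<le> N" by (simp add: N_def sum_nonneg)
  have d: "\<bar>Im z\<bar> * (1 + N) \<le> cmod ?d"
    using cmod_add_bilin_ge[OF z, of n ys y] by (simp add: N_def b_def)
  have pos: "0 < \<bar>Im z\<bar> * (1 + N)" using z N by (intro mult_pos_pos) auto
  have "trc n (resolvent n z ys) - trc n (resolvent n z (y # ys)) = (\<Sum>i<n. b i * b i) / ?d"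
    by (simp add: trc_def b_def sum_subtractf sum_divide_distrib)
  also have "cmod \<dots> \<le> N / cmod ?d"
    unfolding norm_divide
    by (intro divide_right_mono order_trans[OF norm_sum]) (auto simp: N_def norm_mult power2_eq_square)
  also have "\<dots> \<le> N / (\<bar>Im z\<bar> * (1 + N))"
    using d pos N by (intro divide_left_mono) (auto intro: mult_pos_pos order_less_le_trans)
  also have "\<dots> \<le> (1 + N) / (\<bar>Im z\<bar> * (1 + N))"
    using pos by (intro divide_right_mono) auto
  also have "\<dots> = 1 / \<bar>Im z\<bar>" using N by simp
  finally show ?thesis .
qed

text \<open>Decouples a column from its resolvent: the form on the left involves \<open>y\<close>
  twice, the one on the right has a matrix free of \<open>y\<close>.\<close>

lemma bilin_resolvent_Cons:
  fixes n :: nat and z :: complex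
  assumes z: "Im z \<noteq> 0"
  defines "q \<equiv> \<lambda>ys y. bilin n (resolvent n z ys) y"
  shows "q (y # ys) y = z * q ys y / (z + q ys y)"
proof -
  define B where "B = resolvent n z ys"
  define b where "b i = (\<Sum>k<n. B i k * of_real (y k))" for i
  have zq: "z + q ys y \<noteq> 0"
    using cmod_add_bilin_ge_Im[OF z, of n ys y] z unfolding q_def by (metis abs_le_zero_iff norm_zero)
  have qb: "(\<Sum>i<n. of_real (y i) * b i) = q ys y" by (simp add: q_def bilin_def b_def B_def)
  have row: "(\<Sum>k<n. (B i k - b i * b k / (z + q ys y)) * of_real (y k)) = b i - b i / (z + q ys y) * q ys y" for i
  proof -
    have "(\<Sum>k<n. (B i k - b i * b k / (z + q ys y)) * of_real (y k))
      = (\<Sum>k<n. B i k * of_real (y k)) - b i / (z + q ys y) * (\<Sum>k<n. of_real (y k) * b k)"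
      unfolding sum_distrib_left sum_subtractf[symmetric] by (intro sum.cong refl) (simp add: algebra_simps)
    then show ?thesis by (simp add: qb b_def[symmetric])
  qed
  have "q (y # ys) y = (\<Sum>i<n. of_real (y i) * (\<Sum>k<n. (B i k - b i * b k / (z + q ys y)) * of_real (y k)))"
    by (simp add: q_def bilin_def b_def B_def)
  also have "\<dots> = (\<Sum>i<n. of_real (y i) * b i) - (\<Sum>i<n. of_real (y i) * b i) / (z + q ys y) * q ys y"
    unfolding row sum_divide_distrib sum_distrib_right sum_subtractf[symmetric]
    by (intro sum.cong refl) (simp add: algebra_simps)
  also have "\<dots> = q ys y - q ys y / (z + q ys y) * q ys y" by (simp add: qb)
  also have "\<dots> = z * q ys y / (z + q ys y)" using zq by (simp add: field_simps)
  finally show ?thesis .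
qed

section \<open>Removing an arbitrary column\<close>

lemma gram_cong_mset: "mset ys = mset ys' \<Longrightarrow> gram z ys i k = gram z ys' i k"
proof -
  assume "mset ys = mset ys'"
  then have "mset (map f ys) = mset (map f ys')" for f :: "(nat \<Rightarrow> real) \<Rightarrow> complex" by simp
  then have "sum_list (map f ys) = sum_list (map f ys')" for f :: "(nat \<Rightarrow> real) \<Rightarrow> complex"
    by (subst (1 2) sum_mset_sum_list[symmetric]) (rule arg_cong)
  then show ?thesis unfolding gram_def by metis
qed

text \<open>A left inverse, obtained by symmetry, and a right inverse of the same matrix agree. This
  allows any column to be treated as the one added last.\<close>

lemma resolvent_cong_mset:
  assumes z: "Im z \<noteq> 0" and ms: "mset ys = mset ys'" and i: "i < n" and k: "k < n"
  shows "resolvent n z ys i k = resolvent n z ys' i k"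
proof -
  let ?B = "resolvent n z ys" and ?B' = "resolvent n z ys'"
  have left: "(\<Sum>l<n. ?B i l * gram z ys l j) = (if i = j then 1 else 0)" if "j < n" for j
    using resolvent_inverse[OF z that i, of ys]
    by (simp add: gram_sym[of z ys _ j] resolvent_sym[of n z ys i] mult.commute eq_commute)
  have "?B' i k = (\<Sum>j<n. (if i = j then 1 else 0) * ?B' j k)"
    using i by (simp add: if_distrib[of "\<lambda>x. x * _"] cong: if_cong)
  also have "\<dots> = (\<Sum>j<n. (\<Sum>l<n. ?B i l * gram z ys l j) * ?B' j k)"
    by (intro sum.cong refl) (simp add: left)
  also have "\<dots> = (\<Sum>l<n. ?B i l * (\<Sum>j<n. gram z ys' l j * ?B' j k))"
    unfolding sum_distrib_left sum_distrib_right
    by (subst sum.swap) (simp add: mult.assoc gram_cong_mset[OF ms])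
  also have "\<dots> = (\<Sum>l<n. if l = k then ?B i l else 0)"
    by (intro sum.cong refl) (use k in \<open>auto simp: resolvent_inverse[OF z]\<close>)
  also have "\<dots> = ?B i k" using k by simp
  finally show ?thesis by simp
qed

text \<open>The index is removed rather than the column, so the list does not involve
  \<open>Y j\<close> even when columns coincide; independence rests on this.\<close>

definition leave_out :: "nat \<Rightarrow> nat \<Rightarrow> (nat \<Rightarrow> nat \<Rightarrow> real) \<Rightarrow> (nat \<Rightarrow> real) list" where
  "leave_out m j Y = map Y (remove1 j [0..<m])"

lemma mset_leave_out: "j < m \<Longrightarrow> mset (Y j # leave_out m j Y) = mset (map Y [0..<m])"
proof -
  assume "j < m"
  then have "add_mset j (mset (remove1 j [0..<m])) = mset [0..<m]"
    by (simp add: insert_DiffM)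
  then have "image_mset Y (add_mset j (mset (remove1 j [0..<m]))) = image_mset Y (mset [0..<m])"
    by (rule arg_cong)
  then show ?thesis unfolding leave_out_def by (simp only: mset.simps mset_map image_mset_add_mset)
qed

text \<open>The trace of \<open>gram * B = 1\<close>, with the contribution of each column collected
  into its own quadratic form.\<close>

lemma trc_gram_identity:
  fixes Y :: "nat \<Rightarrow> nat \<Rightarrow> real" and n m :: nat and z :: complex
  assumes z: "Im z \<noteq> 0"
  defines "B \<equiv> resolvent n z (map Y [0..<m])"
  shows "of_nat n + z * trc n B = (\<Sum>j<m. bilin n B (Y j) / z)"
proof -
  have "of_nat n = (\<Sum>i<n. \<Sum>k<n. gram z (map Y [0..<m]) i k * B k i)"
    by (simp add: resolvent_inverse[OF z] B_def)
  also have "\<dots> = (\<Sum>i<n. \<Sum>k<n. (\<Sum>j<m. of_real (Y j i) * of_real (Y j k)) / z * B k i)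
     - (\<Sum>i<n. \<Sum>k<n. if k = i then z * B i i else 0)"
    unfolding sum_subtractf[symmetric]
    by (intro sum.cong refl)
       (auto simp: gram_def comp_def interv_sum_list_conv_sum_set_nat atLeast0LessThan left_diff_distrib)
  also have "(\<Sum>i<n. \<Sum>k<n. if k = i then z * B i i else 0) = z * trc n B"
    by (simp add: trc_def sum_distrib_left)
  also have "(\<Sum>i<n. \<Sum>k<n. (\<Sum>j<m. of_real (Y j i) * of_real (Y j k)) / z * B k i)
    = (\<Sum>i<n. \<Sum>k<n. \<Sum>j<m. of_real (Y j i) * (B i k * of_real (Y j k)) / z)"
  proof (intro sum.cong refl)
    fix i k
    have sym: "B k i = B i k" unfolding B_def by (rule resolvent_sym)
    show "(\<Sum>j<m. of_real (Y j i) * of_real (Y j k)) / z * B k i = (\<Sum>j<m. of_real (Y j i) * (B i k * of_real (Y j k)) / z)"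
      unfolding sym sum_divide_distrib sum_distrib_right by (intro sum.cong refl) simp
  qed
  also have "\<dots> = (\<Sum>j<m. bilin n B (Y j) / z)"
    by (subst sum.swap[of _ "{..<m}"], subst sum.swap[of _ "{..<m}"])
       (simp add: bilin_def sum_distrib_left sum_divide_distrib)
  finally show ?thesis by simp
qed

lemma trc_resolvent_identity:
  fixes Y :: "nat \<Rightarrow> nat \<Rightarrow> real" and n m :: nat and z :: complex
  assumes z: "Im z \<noteq> 0"
  defines "q \<equiv> \<lambda>j. bilin n (resolvent n z (leave_out m j Y)) (Y j)"
  shows "of_nat n + z * trc n (resolvent n z (map Y [0..<m])) = (\<Sum>j<m. q j / (z + q j))"
proof -
  let ?B = "resolvent n z (map Y [0..<m])"
  have z0: "z \<noteq> 0" using z by auto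
  have qB: "bilin n ?B (Y j) = z * q j / (z + q j)" if "j < m" for j
  proof -
    have "bilin n ?B (Y j) = bilin n (resolvent n z (Y j # leave_out m j Y)) (Y j)"
      unfolding bilin_def
      by (intro sum.cong refl arg_cong2[of _ _ _ _ "(*)"] resolvent_cong_mset[OF z])
         (use mset_leave_out[OF that, of Y] in auto)
    then show ?thesis using bilin_resolvent_Cons[OF z, of n "Y j" "leave_out m j Y"] by (simp add: q_def)
  qed
  show ?thesis
    unfolding trc_gram_identity[OF z] by (intro sum.cong refl) (use z0 in \<open>simp add: qB\<close>)
qed

section \<open>The quadratic equation of the limit and its stability\<close>

definition stieltjes_pol :: "real \<Rightarrow> complex \<Rightarrow> complex \<Rightarrow> complex" where
  "stieltjes_pol c z s = (1 + z * s) * (z + s) - of_real c * s"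

text \<open>\<open>stieltjes_pol\<close> is what \<open>trc_resolvent_identity\<close> becomes when
  every \<open>q j\<close> is replaced by \<open>s\<close>, \<open>m / n\<close> by
  \<open>c\<close>, and the denominator \<open>z + s\<close> is cleared. Solved for the inverse root
  it reads \<open>1 / s1 = c / (z + s1) - z\<close>; as \<open>z + s1\<close> lies strictly in the
  half-plane of \<open>z\<close>, both terms point to the opposite one.\<close>

lemma inverse_root_Im:
  assumes z: "Im z \<noteq> 0" and c: "c \<ge> 0" and s1: "s1 \<noteq> 0" "0 \<le> Im s1 * Im z"
    and root: "stieltjes_pol c z s1 = 0"
  shows "Im (1 / s1) * Im z \<le> - (Im z)\<^sup>2"
proof -
  have "Im (z + s1) * Im z > 0" using z s1(2) by (simp add: distrib_right power2_eq_square[symmetric] add_pos_nonneg)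
  then have w: "z + s1 \<noteq> 0" by (metis mult_zero_left less_irrefl zero_complex.sel(2))
  have "1 / s1 = of_real c / (z + s1) - z"
    using root s1(1) w by (simp add: stieltjes_pol_def field_simps)
  moreover have "Im (of_real c / w - z) * Im z = - (c * (Im w * Im z) / (cmod w)\<^sup>2) - (Im z)\<^sup>2" for w
    by (simp add: Im_divide cmod_power2) (simp add: power2_eq_square algebra_simps)
  ultimately have "Im (1 / s1) * Im z = - (c * (Im (z + s1) * Im z) / (cmod (z + s1))\<^sup>2) - (Im z)\<^sup>2"
    by metis
  moreover have "0 \<le> c * (Im (z + s1) * Im z) / (cmod (z + s1))\<^sup>2"
    using \<open>Im (z + s1) * Im z > 0\<close> c by simp
  ultimately show ?thesis by linarith
qed

text \<open>The two roots have product 1, and \<open>1 / s1\<close> lies in the half-plane opposite to \<open>z\<close>, at distance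
  at least \<open>\<bar>Im z\<bar>\<close> from the real axis and hence from \<open>s\<close>.\<close>
lemma stieltjes_pol_stable:
  assumes z: "Im z \<noteq> 0" and c: "c \<ge> 0" and s1: "s1 \<noteq> 0" "0 \<le> Im s1 * Im z"
    and root: "stieltjes_pol c z s1 = 0" and s: "0 \<le> Im s * Im z"
  shows "cmod z * \<bar>Im z\<bar> * cmod (s - s1) \<le> cmod (stieltjes_pol c z s)"
proof -
  have "(Im z)\<^sup>2 \<le> Im (s - 1 / s1) * Im z"
    using inverse_root_Im[OF z c s1 root] s by (simp add: left_diff_distrib)
  also have "\<dots> \<le> \<bar>Im (s - 1 / s1)\<bar> * \<bar>Im z\<bar>" using abs_ge_self[of "Im (s - 1 / s1) * Im z"] by (simp only: abs_mult)
  also have "\<dots> \<le> cmod (s - 1 / s1) * \<bar>Im z\<bar>" by (intro mult_right_mono abs_Im_le_cmod) auto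
  finally have "\<bar>Im z\<bar> * \<bar>Im z\<bar> \<le> cmod (s - 1 / s1) * \<bar>Im z\<bar>" by (simp add: power2_eq_square)
  then have ge: "\<bar>Im z\<bar> \<le> cmod (s - 1 / s1)" 
    using mult_right_le_imp_le[of "\<bar>Im z\<bar>" "\<bar>Im z\<bar>"] z by auto
  have lin: "z\<^sup>2 + 1 - of_real c = - z * (s1 + 1 / s1)"
    using root s1(1) by (simp add: stieltjes_pol_def field_simps power2_eq_square)
  have "stieltjes_pol c z s = z * s\<^sup>2 + (z\<^sup>2 + 1 - of_real c) * s + z"
    by (simp add: stieltjes_pol_def power2_eq_square algebra_simps)
  also have "\<dots> = z * (s - s1) * (s - 1 / s1)"
    unfolding lin using s1(1) by (simp add: field_simps power2_eq_square)
  finally have "cmod (stieltjes_pol c z s) = cmod z * cmod (s - s1) * cmod (s - 1 / s1)"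
    by (simp add: norm_mult)
  moreover have "cmod z * cmod (s - s1) * \<bar>Im z\<bar> \<le> cmod z * cmod (s - s1) * cmod (s - 1 / s1)"
    using ge by (intro mult_left_mono) auto
  ultimately show ?thesis by (simp add: mult_ac)
qed

lemma normalized_trace_Im:
  assumes "Im z \<noteq> 0"
  shows "0 \<le> Im (trc n (resolvent n z ys) / of_nat n) * Im z"
proof -
  have "0 \<le> (\<Sum>i<n. Im (resolvent n z ys i i) * Im z)"
    by (intro sum_nonneg resolvent_diag_Im[OF assms]) auto
  then have "0 \<le> (\<Sum>i<n. Im (resolvent n z ys i i)) * Im z / real n"
    by (simp add: sum_distrib_right)
  then show ?thesis by (simp add: trc_def Im_divide_of_nat)
qed

lemma normalized_trace_norm:
  assumes "Im z \<noteq> 0" and n: "n > 0"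
  shows "cmod (trc n (resolvent n z ys) / of_nat n) \<le> 1 / \<bar>Im z\<bar>"
proof -
  have "cmod (trc n (resolvent n z ys)) \<le> (\<Sum>i<n. 1 / \<bar>Im z\<bar>)"
    unfolding trc_def by (intro sum_norm_le resolvent_diag_norm[OF assms(1)]) auto
  then show ?thesis using n by (simp add: norm_divide field_simps)
qed

text \<open>A deterministic estimate, leaving to probability only the size of the first term. The
  three terms come from the fluctuation of the quadratic forms, from the removal of one column, and
  from the mismatch between \<open>m / n\<close> and \<open>c\<close>.\<close>

lemma stieltjes_deviation:
  fixes n m :: nat and z s1 :: complex and Y :: "nat \<Rightarrow> nat \<Rightarrow> real" and c :: real
  defines "B \<equiv> \<lambda>j. resolvent n z (leave_out m j Y)"
    and "s \<equiv> trc n (resolvent n z (map Y [0..<m])) / of_nat n"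
  assumes z: "Im z \<noteq> 0" and c: "c \<ge> 0" and s1: "s1 \<noteq> 0" "0 \<le> Im s1 * Im z"
    and root: "stieltjes_pol c z s1 = 0" and n: "n > 0"
  shows "cmod (s - s1) \<le> 1 / (Im z)\<^sup>2 * (\<Sum>j<m. cmod (bilin n (B j) (Y j) - trc n (B j) / of_nat n)) / real n
    + (real m / real n) / (real n * \<bar>Im z\<bar> ^ 3) + \<bar>real m / real n - c\<bar> / \<bar>Im z\<bar> ^ 3"
proof -
  define v where "v = \<bar>Im z\<bar>"
  have v: "v > 0" using z by (simp add: v_def)
  define q where "q j = bilin n (B j) (Y j)" for j
  define \<epsilon> where "\<epsilon> j = cmod (q j - trc n (B j) / of_nat n)" for j
  define r where "r = real m / real n"
  have zq: "v \<le> cmod (z + q j)" for j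
    unfolding v_def q_def B_def by (rule cmod_add_bilin_ge_Im[OF z])
  then have zq0: "z + q j \<noteq> 0" for j using v by (metis norm_zero not_le)
  have zv: "v \<le> cmod z" unfolding v_def by (rule abs_Im_le_cmod)
  have sn: "cmod s \<le> 1 / v" unfolding s_def v_def by (rule normalized_trace_norm[OF z n])
  have sIm: "0 \<le> Im s * Im z" unfolding s_def by (rule normalized_trace_Im[OF z])
  have qs: "cmod (q j - s) \<le> \<epsilon> j + 1 / (real n * v)" if "j < m" for j
  proof -
    have "trc n (resolvent n z (map Y [0..<m])) = trc n (resolvent n z (Y j # leave_out m j Y))"
      unfolding trc_def
      by (intro sum.cong refl resolvent_cong_mset[OF z]) (use mset_leave_out[OF that, of Y] in auto)
    then have "cmod (trc n (B j) - trc n (resolvent n z (map Y [0..<m]))) \<le> 1 / v"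
      using trc_resolvent_Cons[OF z, of n "leave_out m j Y" "Y j"] by (simp add: v_def B_def)
    then have "cmod (trc n (B j) / of_nat n - s) \<le> 1 / (real n * v)"
      using n v unfolding s_def diff_divide_distrib[symmetric] norm_divide by (simp add: field_simps)
    moreover have "q j - s = (q j - trc n (B j) / of_nat n) + (trc n (B j) / of_nat n - s)" by simp
    ultimately show ?thesis unfolding \<epsilon>_def by (metis add_left_mono norm_triangle_ineq order_trans)
  qed
  have "of_nat n * (1 + z * s) = (\<Sum>j<m. q j / (z + q j))"
    using trc_resolvent_identity[OF z, where n = n and m = m and Y = Y] n by (simp add: s_def q_def B_def algebra_simps)
  moreover have "of_nat n * stieltjes_pol c z s = of_nat n * (1 + z * s) * (z + s) - of_nat n * of_real c * s"
    by (simp add: stieltjes_pol_def algebra_simps)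
  ultimately have "of_nat n * stieltjes_pol c z s = (\<Sum>j<m. q j / (z + q j)) * (z + s) - of_nat n * of_real c * s"
    by metis
  also have "\<dots> = (\<Sum>j<m. q j / (z + q j) * (z + s) - s) + of_nat n * of_real (r - c) * s"
    unfolding sum_subtractf sum_distrib_right[symmetric] using n by (simp add: r_def algebra_simps)
  \<comment> \<open>The factor \<open>z\<close> that splits off here cancels the
    \<open>cmod z\<close> of \<open>stieltjes_pol_stable\<close>, so that the final bound depends on
    \<open>v\<close> alone.\<close>
  also have "(\<Sum>j<m. q j / (z + q j) * (z + s) - s) = z * (\<Sum>j<m. (q j - s) / (z + q j))"
    unfolding sum_distrib_left
    by (intro sum.cong refl) (use zq0 in \<open>simp add: field_simps\<close>)
  finally have "of_nat n * stieltjes_pol c z s = z * (\<Sum>j<m. (q j - s) / (z + q j)) + of_nat n * of_real (r - c) * s" .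
  then have pol: "cmod (of_nat n * stieltjes_pol c z s)
    \<le> cmod z * cmod (\<Sum>j<m. (q j - s) / (z + q j)) + real n * \<bar>r - c\<bar> * cmod s"
    using norm_triangle_ineq[of "z * (\<Sum>j<m. (q j - s) / (z + q j))" "of_nat n * of_real (r - c) * s"]
    by (simp only: norm_mult norm_of_nat norm_of_real)
  have "cmod (\<Sum>j<m. (q j - s) / (z + q j)) \<le> (\<Sum>j<m. (\<epsilon> j + 1 / (real n * v)) / v)"
  proof (rule sum_norm_le)
    fix j assume "j \<in> {..<m}"
    then show "cmod ((q j - s) / (z + q j)) \<le> (\<epsilon> j + 1 / (real n * v)) / v"
      unfolding norm_divide using qs[of j] zq[of j] v order_trans[OF norm_ge_zero qs[of j]] by (intro frac_le) auto
  qed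
  then have fluct: "cmod z * cmod (\<Sum>j<m. (q j - s) / (z + q j)) \<le> cmod z * (\<Sum>j<m. (\<epsilon> j + 1 / (real n * v)) / v)"
    by (rule mult_left_mono) simp
  have "real n * \<bar>r - c\<bar> * cmod s \<le> real n * \<bar>r - c\<bar> * (1 / v)"
    by (intro mult_left_mono sn) auto
  \<comment> \<open>One power of \<open>1 / v\<close> is spent to produce the factor
    \<open>cmod z\<close>, which can then be cancelled here too.\<close>
  also have "\<dots> \<le> cmod z * (real n * \<bar>r - c\<bar> / v\<^sup>2)"
    using mult_right_mono[OF zv, of "real n * \<bar>r - c\<bar> / v\<^sup>2"] v by (simp add: power2_eq_square)
  finally have up: "cmod (of_nat n * stieltjes_pol c z s)
      \<le> cmod z * ((\<Sum>j<m. (\<epsilon> j + 1 / (real n * v)) / v) + real n * \<bar>r - c\<bar> / v\<^sup>2)"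
    using pol fluct unfolding distrib_left by linarith
  have "real n * (cmod z * v * cmod (s - s1)) \<le> cmod (of_nat n * stieltjes_pol c z s)"
    unfolding norm_mult norm_of_nat v_def
    by (intro mult_left_mono stieltjes_pol_stable[OF z c s1 root sIm]) auto
  with up have "cmod z * (real n * v * cmod (s - s1)) \<le> cmod z * ((\<Sum>j<m. (\<epsilon> j + 1 / (real n * v)) / v) + real n * \<bar>r - c\<bar> / v\<^sup>2)"
    by (simp add: mult_ac)
  then have "real n * v * cmod (s - s1) \<le> (\<Sum>j<m. (\<epsilon> j + 1 / (real n * v)) / v) + real n * \<bar>r - c\<bar> / v\<^sup>2"
    using zv v z by (auto simp add: mult_le_cancel_left)
  then have "cmod (s - s1) \<le> ((\<Sum>j<m. (\<epsilon> j + 1 / (real n * v)) / v) + real n * \<bar>r - c\<bar> / v\<^sup>2) / (real n * v)"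
    using n v by (simp add: pos_le_divide_eq mult_ac)
  also have "(\<Sum>j<m. (\<epsilon> j + 1 / (real n * v)) / v) = (\<Sum>j<m. \<epsilon> j) / v + real m / (real n * v\<^sup>2)"
    using v n by (simp add: add_divide_distrib sum.distrib sum_divide_distrib power2_eq_square)
  also have "((\<Sum>j<m. \<epsilon> j) / v + real m / (real n * v\<^sup>2) + real n * \<bar>r - c\<bar> / v\<^sup>2) / (real n * v)
    = 1 / v\<^sup>2 * (\<Sum>j<m. \<epsilon> j) / real n + r / (real n * v ^ 3) + \<bar>r - c\<bar> / v ^ 3"
    using v n by (simp add: r_def field_simps power2_eq_square power3_eq_cube)
  finally show ?thesis by (simp add: v_def r_def \<epsilon>_def q_def)
qed

section \<open>From the block matrix to the trace of the resolvent\<close>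

lemma sum_lessThan_add: "(\<Sum>c<n + m. f c) = (\<Sum>c<m. f c) + (\<Sum>k<n. f (m + k))"
  for f :: "nat \<Rightarrow> 'a::comm_monoid_add"
  by (induction n) (simp_all add: add.assoc add.commute[of m])

lemma mat_inverse_eqI:
  fixes A :: "'a::field mat"
  assumes A: "A \<in> carrier_mat N N" and K: "K \<in> carrier_mat N N" and AK: "A * K = 1\<^sub>m N"
  shows "mat_inverse A = Some K"
proof -
  have KA: "K * A = 1\<^sub>m N" by (rule mat_mult_left_right_inverse[OF A K AK])
  have "A \<in> Units (ring_mat TYPE('a) N ())"
    unfolding Units_def using A K AK KA by (auto simp: ring_mat_simps ring_mat_def)
  then obtain G where G: "mat_inverse A = Some G"
    using mat_inverse(1)[OF A, of "()"] by (cases "mat_inverse A") auto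
  from mat_inverse(2)[OF A G] have "G * A = 1\<^sub>m N" "G \<in> carrier_mat N N" by auto
  then have "G = G * (A * K)" using AK by simp
  also have "\<dots> = K" using A K \<open>G \<in> carrier_mat N N\<close> \<open>G * A = 1\<^sub>m N\<close>
    by (simp add: assoc_mult_mat[symmetric, of _ N N _ N _ N])
  finally show ?thesis using G by simp
qed

definition column :: "nat \<Rightarrow> (nat \<Rightarrow> nat \<Rightarrow> real) \<Rightarrow> nat \<Rightarrow> nat \<Rightarrow> real" where
  "column n \<omega> j i = Ymat n \<omega> i j"

text \<open>Inverting the block matrix by the Schur complement of its upper left block \<open>- z\<close>, which is
  \<open>Y Y^T / z - z\<close>.\<close>
lemma snm_eq_trc:
  assumes z: "Im z \<noteq> 0"
  shows "snm n m \<omega> z = (2 * trc n (resolvent n z (map (column n \<omega>) [0..<m])) + (of_nat n - of_nat m) / z) / of_nat (n + m)"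
proof -
  define y where "y j i = complex_of_real (column n \<omega> j i)" for j i
  define B where "B = resolvent n z (map (column n \<omega>) [0..<m])"
  define u where "u b i = (\<Sum>l<n. B i l * y b l)" for b i
  define Q where "Q a b = (\<Sum>k<n. y a k * u b k)" for a b
  define A where "A = Wmat n m \<omega> - z \<cdot>\<^sub>m 1\<^sub>m (n + m)"
  define K where "K = Matrix.mat (n + m) (n + m) (\<lambda>(a, b).
    if a < m then (if b < m then (if a = b then - 1 / z else 0) + Q a b / z\<^sup>2 else u a (b - m) / z)
    else (if b < m then u b (a - m) / z else B (a - m) (b - m)))"
  have z0: "z \<noteq> 0" using z by auto
  have gram: "gram z (map (column n \<omega>) [0..<m]) i k = (\<Sum>c<m. y c i * y c k) / z - (if i = k then z else 0)" for i k
    by (simp add: gram_def y_def comp_def interv_sum_list_conv_sum_set_nat atLeast0LessThan)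
  have inv: "(\<Sum>c<m. y c i * (\<Sum>k<n. y c k * B k l)) / z - z * B i l = (if i = l then 1 else 0)"
    if "i < n" "l < n" for i l
  proof -
    have "(\<Sum>c<m. y c i * (\<Sum>k<n. y c k * B k l)) / z = (\<Sum>k<n. (\<Sum>c<m. y c i * y c k) / z * B k l)"
      unfolding sum_distrib_left sum_distrib_right sum_divide_distrib
      by (subst sum.swap) (simp add: mult_ac)
    moreover have "z * B i l = (\<Sum>k<n. (if i = k then z else 0) * B k l)"
      using that by (simp add: if_distrib[of "\<lambda>x. x * _"] cong: if_cong)
    ultimately have "(\<Sum>c<m. y c i * (\<Sum>k<n. y c k * B k l)) / z - z * B i l
      = (\<Sum>k<n. gram z (map (column n \<omega>) [0..<m]) i k * B k l)"
      by (simp add: gram left_diff_distrib sum_subtractf)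
    then show ?thesis using resolvent_inverse[OF z that] by (simp add: B_def)
  qed
  have yB: "(\<Sum>k<n. y c k * B k l) = u c l" for c l
    by (simp add: u_def B_def resolvent_sym[of n z _ l] mult.commute)
  have inv_u: "(\<Sum>c<m. y c i * Q c b) / z - z * u b i = y b i" if i: "i < n" for i b
  proof -
    have "Q c b = (\<Sum>l<n. (\<Sum>k<n. y c k * B k l) * y b l)" for c
      unfolding Q_def u_def sum_distrib_left sum_distrib_right
      by (subst sum.swap) (simp add: mult_ac)
    then have "(\<Sum>c<m. y c i * Q c b) = (\<Sum>l<n. (\<Sum>c<m. y c i * u c l) * y b l)"
      unfolding yB by (simp add: sum_distrib_left sum_distrib_right mult.assoc) (rule sum.swap)
    then have "(\<Sum>c<m. y c i * Q c b) / z = (\<Sum>l<n. (\<Sum>c<m. y c i * u c l) / z * y b l)"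
      by (simp only:) (subst sum_divide_distrib, simp)
    moreover have "z * u b i = (\<Sum>l<n. z * B i l * y b l)"
      by (simp add: u_def sum_distrib_left mult.assoc)
    ultimately have "(\<Sum>c<m. y c i * Q c b) / z - z * u b i = (\<Sum>l<n. ((\<Sum>c<m. y c i * u c l) / z - z * B i l) * y b l)"
      by (simp add: left_diff_distrib sum_subtractf)
    also have "\<dots> = (\<Sum>l<n. if l = i then y b l else 0)"
      by (intro sum.cong refl) (use inv[OF i, unfolded yB] in auto)
    finally show ?thesis using i by simp
  qed
  have Acar: "A \<in> carrier_mat (n + m) (n + m)" and Kcar: "K \<in> carrier_mat (n + m) (n + m)"
    by (auto simp: A_def K_def Wmat_def)
  have A_ul: "A $$ (a, c) = (if a = c then - z else 0)" if "a < m" "c < m" for a c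
    using that by (simp add: A_def Wmat_def)
  have A_ur: "A $$ (a, m + k) = y a k" if "a < m" "k < n" for a k
    using that by (simp add: A_def Wmat_def y_def column_def)
  have A_ll: "A $$ (m + i, c) = y c i" if "c < m" "i < n" for i c
    using that by (simp add: A_def Wmat_def y_def column_def)
  have A_lr: "A $$ (m + i, m + k) = (if i = k then - z else 0)" if "i < n" "k < n" for i k
    using that by (simp add: A_def Wmat_def)
  have K_u: "K $$ (a, b) = (if b < m then (if a = b then - 1 / z else 0) + Q a b / z\<^sup>2 else u a (b - m) / z)"
    if "a < m" "b < n + m" for a b
    using that by (simp add: K_def)
  have K_l: "K $$ (m + k, b) = (if b < m then u b k / z else B k (b - m))" if "k < n" "b < n + m" for k b
    using that by (simp add: K_def)
  have "A * K = 1\<^sub>m (n + m)"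
  proof (rule eq_matI)
    fix a b assume "a < dim_row (1\<^sub>m (n + m))" "b < dim_col (1\<^sub>m (n + m))"
    then have ab: "a < n + m" "b < n + m" by auto
    have "(A * K) $$ (a, b) = (\<Sum>c<n + m. A $$ (a, c) * K $$ (c, b))"
      using ab Acar Kcar by (simp add: Matrix.scalar_prod_def atLeast0LessThan)
    also have "\<dots> = (\<Sum>c<m. A $$ (a, c) * K $$ (c, b)) + (\<Sum>k<n. A $$ (a, m + k) * K $$ (m + k, b))"
      by (rule sum_lessThan_add)
    also have "\<dots> = (if a = b then 1 else 0)"
    proof (cases "a < m")
      case True
      have "(\<Sum>c<m. A $$ (a, c) * K $$ (c, b)) = (\<Sum>c<m. if c = a then - z * K $$ (a, b) else 0)"
        by (intro sum.cong refl) (use True in \<open>auto simp: A_ul\<close>)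
      also have "\<dots> = - z * K $$ (a, b)" using True by simp
      finally have 1: "(\<Sum>c<m. A $$ (a, c) * K $$ (c, b)) = - z * K $$ (a, b)" .
      have 2: "(\<Sum>k<n. A $$ (a, m + k) * K $$ (m + k, b)) = (\<Sum>k<n. y a k * (if b < m then u b k / z else B k (b - m)))"
        by (intro sum.cong refl) (use True ab in \<open>simp add: A_ur K_l\<close>)
      show ?thesis
      proof (cases "b < m")
        case True
        then have "(\<Sum>k<n. y a k * (if b < m then u b k / z else B k (b - m))) = Q a b / z"
          by (simp add: Q_def sum_divide_distrib)
        then show ?thesis unfolding 1 2 using True \<open>a < m\<close> ab z0
          by (simp add: K_u field_simps power2_eq_square)
      next
        case False
        then show ?thesis unfolding 1 2 using \<open>a < m\<close> ab z0 by (auto simp: K_u yB)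
      qed
    next
      case False
      define i where "i = a - m"
      have i: "a = m + i" "i < n" using False ab by (auto simp: i_def)
      have 2: "(\<Sum>k<n. A $$ (a, m + k) * K $$ (m + k, b)) = (\<Sum>k<n. if k = i then - z * K $$ (m + i, b) else 0)"
        by (intro sum.cong refl) (use i in \<open>auto simp: A_lr\<close>)
      have 1: "(\<Sum>c<m. A $$ (a, c) * K $$ (c, b)) = (\<Sum>c<m. y c i * K $$ (c, b))"
        by (intro sum.cong refl) (use i in \<open>simp add: A_ll\<close>)
      show ?thesis
      proof (cases "b < m")
        case True
        have "(\<Sum>c<m. y c i * K $$ (c, b)) = (\<Sum>c<m. (if c = b then - y b i / z else 0) + y c i * Q c b / z\<^sup>2)"
          by (intro sum.cong refl) (use True ab in \<open>auto simp: K_u algebra_simps\<close>)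
        also have "\<dots> = - y b i / z + (\<Sum>c<m. y c i * Q c b) / z\<^sup>2"
          using True by (simp add: sum.distrib sum_divide_distrib)
        also have "(\<Sum>c<m. y c i * Q c b) / z\<^sup>2 = (y b i + z * u b i) / z"
          using inv_u[OF i(2), of b] z0 by (simp add: field_simps power2_eq_square)
        finally show ?thesis unfolding 1 2 using i ab True z0 by (simp add: K_l add_divide_distrib)
      next
        case False
        define l where "l = b - m"
        have l: "b = m + l" "l < n" using False ab by (auto simp: l_def)
        have "(\<Sum>c<m. y c i * K $$ (c, b)) = (\<Sum>c<m. y c i * u c l) / z"
          unfolding sum_divide_distrib by (intro sum.cong refl) (use ab l in \<open>auto simp: K_u\<close>)
        then show ?thesis unfolding 1 2 using i l ab inv[OF i(2) l(2)] by (simp add: K_l yB)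
      qed
    qed
    also have "\<dots> = 1\<^sub>m (n + m) $$ (a, b)" using ab by simp
    finally show "(A * K) $$ (a, b) = 1\<^sub>m (n + m) $$ (a, b)" .
  qed (use Acar Kcar in auto)
  then have inverse: "the (mat_inverse A) = K"
    using mat_inverse_eqI[OF Acar Kcar] by simp
  \<comment> \<open>By \<open>trc_gram_identity\<close> the upper left block has trace
    \<open>trc n B + (of_nat n - of_nat m) / z\<close>, so both diagonal blocks contribute
    \<open>trc n B\<close>.\<close>
  have "(\<Sum>a<n + m. K $$ (a, a)) = (\<Sum>a<m. - 1 / z + Q a a / z\<^sup>2) + (\<Sum>k<n. B k k)"
    by (simp add: sum_lessThan_add K_u K_l)
  also have "(\<Sum>a<m. - 1 / z + Q a a / z\<^sup>2) = - of_nat m / z + (\<Sum>a<m. Q a a / z) / z"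
    by (simp add: sum.distrib sum_divide_distrib power2_eq_square sum_subtractf sum_negf)
  also have "(\<Sum>a<m. Q a a / z) = of_nat n + z * trc n B"
    using trc_gram_identity[OF z, where n = n and m = m and Y = "column n \<omega>"]
    by (simp add: B_def Q_def u_def bilin_def y_def)
  finally have "(\<Sum>a<n + m. K $$ (a, a)) = 2 * trc n B + (of_nat n - of_nat m) / z"
    using z0 by (simp add: trc_def add_divide_distrib diff_divide_distrib)
  then show ?thesis
    unfolding snm_def A_def[symmetric] inverse Let_def by (simp add: B_def)
qed

lemma snm_deviation:
  fixes n m :: nat and \<omega> :: "nat \<Rightarrow> nat \<Rightarrow> real" and z s1 :: complex and c :: real
  defines "s \<equiv> trc n (resolvent n z (map (column n \<omega>) [0..<m])) / of_nat n"
  assumes z: "Im z \<noteq> 0" and n: "n > 0" and c: "c \<ge> 0" and s1: "cmod s1 \<le> 1 / \<bar>Im z\<bar>"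
  shows "cmod (snm n m \<omega> z - (2 * s1 - (of_real c - 1) / z) / (1 + of_real c))
    \<le> 2 * cmod (s - s1) + 4 * \<bar>real m / real n - c\<bar> / \<bar>Im z\<bar>"
proof -
  define r where "r = real m / real n"
  have r: "0 \<le> r" by (simp add: r_def)
  have z0: "z \<noteq> 0" using z by auto
  have rc: "1 + complex_of_real r \<noteq> 0" "1 + complex_of_real c \<noteq> 0"
    using r c by (auto simp: complex_eq_iff)
  have "snm n m \<omega> z = (of_nat n * (2 * s - (of_real r - 1) / z)) / (of_nat n * (1 + of_real r))"
    unfolding snm_eq_trc[OF z] using n z0
    by (intro arg_cong2[of _ _ _ _ "(/)"]) (simp_all add: s_def r_def field_simps)
  then have snm: "snm n m \<omega> z = (2 * s - (of_real r - 1) / z) / (1 + of_real r)" using n by simp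
  have "snm n m \<omega> z - (2 * s1 - (of_real c - 1) / z) / (1 + of_real c)
    = 2 * (s - s1) / (1 + of_real r) - 2 * (of_real (r - c)) * (s1 + 1 / z) / ((1 + of_real r) * (1 + of_real c))"
  proof -
    \<comment> \<open>\<open>R\<close> and \<open>C\<close> stand for \<open>1 + r\<close> and
      \<open>1 + c\<close>, so \<open>R - 2\<close> and \<open>C - 2\<close> are the numerators
      \<open>r - 1\<close> and \<open>c - 1\<close>.\<close>
    have "(2 * s - (R - 2) / z) / R - (2 * s1 - (C - 2) / z) / C
      = 2 * (s - s1) / R - 2 * (R - C) * (s1 + 1 / z) / (R * C)" if "R \<noteq> 0" "C \<noteq> 0" for R C :: complex
      using that z0 by (simp add: field_simps)
    from this[OF rc] show ?thesis using snm by simp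
  qed
  also have "cmod \<dots> \<le> cmod (2 * (s - s1) / (1 + of_real r))
    + cmod (2 * (of_real (r - c)) * (s1 + 1 / z) / ((1 + of_real r) * (1 + of_real c)))"
    by (rule norm_triangle_ineq4)
  also have "\<dots> \<le> 2 * cmod (s - s1) + 4 * \<bar>r - c\<bar> / \<bar>Im z\<bar>"
  proof (rule add_mono)
    have r1: "cmod (1 + of_real r) = 1 + r" "cmod (1 + of_real c) = 1 + c"
      using r c by (metis abs_of_nonneg add_nonneg_nonneg norm_of_real of_real_1 of_real_add zero_le_one)+
    have "2 * cmod (s - s1) / (1 + r) \<le> 2 * cmod (s - s1) / 1"
      using r by (intro divide_left_mono) auto
    then show "cmod (2 * (s - s1) / (1 + of_real r)) \<le> 2 * cmod (s - s1)"
      unfolding norm_divide norm_mult r1 by simp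
    have "cmod (s1 + 1 / z) \<le> 1 / \<bar>Im z\<bar> + 1 / \<bar>Im z\<bar>"
    proof (rule order_trans[OF norm_triangle_ineq] , rule add_mono[OF s1])
      show "cmod (1 / z) \<le> 1 / \<bar>Im z\<bar>"
        using z z0 abs_Im_le_cmod[of z] by (auto simp: norm_divide intro!: divide_left_mono mult_pos_pos)
    qed
    then have "2 * \<bar>r - c\<bar> * cmod (s1 + 1 / z) \<le> 2 * \<bar>r - c\<bar> * (1 / \<bar>Im z\<bar> + 1 / \<bar>Im z\<bar>)"
      by (intro mult_left_mono) auto
    moreover have "2 * \<bar>r - c\<bar> * cmod (s1 + 1 / z) / ((1 + r) * (1 + c)) \<le> 2 * \<bar>r - c\<bar> * cmod (s1 + 1 / z) / 1"
    proof (rule divide_left_mono)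
      show "1 \<le> (1 + r) * (1 + c)" using mult_mono[of 1 "1 + r" 1 "1 + c"] r c by simp
      then show "0 < (1 + r) * (1 + c) * 1" by simp
    qed auto
    moreover have "cmod (2 * (of_real (r - c)) * (s1 + 1 / z) / ((1 + of_real r) * (1 + of_real c)))
        = 2 * \<bar>r - c\<bar> * cmod (s1 + 1 / z) / ((1 + r) * (1 + c))"
      unfolding norm_divide norm_mult norm_of_real r1 by simp
    ultimately show "cmod (2 * (of_real (r - c)) * (s1 + 1 / z) / ((1 + of_real r) * (1 + of_real c)))
        \<le> 4 * \<bar>r - c\<bar> / \<bar>Im z\<bar>"
      by simp
  qed
  finally show ?thesis by (simp add: r_def)
qed

section \<open>Stieltjes transforms of the limit\<close>

lemma integrable_stieltjes_kernel:
  assumes "prob_space H" and [measurable_cong]: "sets H = sets borel" and z: "Im z \<noteq> 0"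
  shows "integrable H (\<lambda>x. inverse (complex_of_real x - z))"
    and "cmod (inverse (complex_of_real x - z)) \<le> 1 / \<bar>Im z\<bar>"
proof -
  interpret prob_space H by fact
  have le: "cmod (inverse (complex_of_real x - z)) \<le> 1 / \<bar>Im z\<bar>" for x
  proof -
    have "\<bar>Im z\<bar> \<le> cmod (complex_of_real x - z)"
      using abs_Im_le_cmod[of "complex_of_real x - z"] by simp
    moreover have "cmod (inverse (complex_of_real x - z)) = 1 / cmod (complex_of_real x - z)"
      by (simp add: norm_inverse divide_inverse)
    ultimately show ?thesis using z by (simp only:) (intro frac_le, auto)
  qed
  then show "cmod (inverse (complex_of_real x - z)) \<le> 1 / \<bar>Im z\<bar>" .
  show "integrable H (\<lambda>x. inverse (complex_of_real x - z))"
    by (rule integrable_const_bound[of _ "1 / \<bar>Im z\<bar>"]) (use le in auto)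
qed

text \<open>The imaginary part of \<open>1 / (x - z)\<close> has the sign of \<open>Im z\<close> for
  real \<open>x\<close>. This sign singles out the right root of the quadratic, so no branch of the
  square root has to be followed.\<close>

lemma
  assumes H: "is_stieltjes_of_prob f" and z: "Im z \<noteq> 0"
  shows stieltjes_Im_nonneg: "0 \<le> Im (f z) * Im z"
    and stieltjes_norm_le: "cmod (f z) \<le> 1 / \<bar>Im z\<bar>"
proof -
  obtain H where H: "prob_space H" "sets H = sets borel" and f: "f z = stieltjes H z"
    using H z unfolding is_stieltjes_of_prob_def by blast
  interpret prob_space H by (rule H(1))
  note int = integrable_stieltjes_kernel(1)[OF H z]
  have "Im (f z) = (\<integral>x. Im (inverse (complex_of_real x - z)) \<partial>H)"
    unfolding f stieltjes_def by (rule integral_Im[symmetric, OF int])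
  then have "Im (f z) * Im z = (\<integral>x. Im (inverse (complex_of_real x - z)) * Im z \<partial>H)"
    by (simp only: integral_mult_left_zero)
  also have "\<dots> \<ge> 0"
  proof (rule Bochner_Integration.integral_nonneg)
    fix x
    show "0 \<le> Im (inverse (complex_of_real x - z)) * Im z" by simp
  qed
  finally show "0 \<le> Im (f z) * Im z" .
  have "cmod (f z) \<le> (\<integral>x. cmod (inverse (complex_of_real x - z)) \<partial>H)"
    unfolding f stieltjes_def by (rule integral_norm_bound)
  also have "\<dots> \<le> (\<integral>x. 1 / \<bar>Im z\<bar> \<partial>H)"
    by (intro integral_mono integrable_norm int integrable_const integrable_stieltjes_kernel(2)[OF H z])
  finally show "cmod (f z) \<le> 1 / \<bar>Im z\<bar>" by (simp add: prob_space)
qed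

lemma root_of_quadratic:
  fixes a b z s w :: complex
  assumes "a \<noteq> 0" "w\<^sup>2 = b\<^sup>2 - 4 * a * z" "s = - 1 / (2 * a) * (b - w)"
  shows "a * s\<^sup>2 + b * s + z = 0"
proof -
  have w: "w = 2 * a * s + b" using assms(1) by (simp add: assms(3) field_simps)
  have "(2 * a * s + b)\<^sup>2 = b\<^sup>2 - 4 * a * z" using assms(2) by (simp add: w)
  then have "4 * a * (a * s\<^sup>2 + b * s + z) = 0"
    by (simp add: power2_eq_square algebra_simps)
  then show ?thesis using assms(1) by simp
qed

text \<open>Both \<open>s1 - (c - 1) / z\<close> and \<open>c s2\<close> solve \<open>z t^2 + (z^2 + c - 1) t + c z = 0\<close>; two distinct
  solutions have product \<open>c\<close> and so cannot both have an imaginary part of the sign of \<open>Im z\<close>.\<close>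
lemma companion_stieltjes:
  fixes z s1 s2 :: complex and c :: real
  assumes z: "Im z \<noteq> 0" and c: "c \<ge> 1"
    and root1: "stieltjes_pol c z s1 = 0" and Im1: "0 \<le> Im s1 * Im z"
    and root2: "of_real c * z * s2\<^sup>2 + (z\<^sup>2 + of_real c - 1) * s2 + z = 0" and Im2: "0 \<le> Im s2 * Im z"
  shows "of_real c * s2 = s1 - (of_real c - 1) / z"
proof (rule ccontr)
  define t1 where "t1 = s1 - (of_real c - 1) / z"
  define t2 where "t2 = of_real c * s2"
  let ?b = "z\<^sup>2 + of_real c - 1"
  assume "of_real c * s2 \<noteq> s1 - (of_real c - 1) / z"
  then have ne: "t1 - t2 \<noteq> 0" by (simp add: t1_def t2_def)
  have z0: "z \<noteq> 0" using z by auto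
  have s1_0: "s1 \<noteq> 0" using root1 z0 by (auto simp: stieltjes_pol_def)
  have q1: "z * t1\<^sup>2 + ?b * t1 + of_real c * z = 0"
  proof -
    have "z * t1\<^sup>2 + ?b * t1 + of_real c * z = stieltjes_pol c z s1"
      using z0 by (simp add: t1_def stieltjes_pol_def field_simps power2_eq_square)
    then show ?thesis using root1 by simp
  qed
  have "z * t2\<^sup>2 + ?b * t2 + of_real c * z = of_real c * (of_real c * z * s2\<^sup>2 + ?b * s2 + z)"
    by (simp add: t2_def power2_eq_square algebra_simps)
  then have q2: "z * t2\<^sup>2 + ?b * t2 + of_real c * z = 0" using root2 by simp
  have "(t1 - t2) * (z * (t1 + t2) + ?b) = (z * t1\<^sup>2 + ?b * t1 + of_real c * z) - (z * t2\<^sup>2 + ?b * t2 + of_real c * z)"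
    by (simp add: power2_eq_square algebra_simps)
  then have b: "z * (t1 + t2) + ?b = 0" using q1 q2 ne by simp
  have "z * (of_real c - t1 * t2) = (z * t1\<^sup>2 + ?b * t1 + of_real c * z) - t1 * (z * (t1 + t2) + ?b)"
    by (simp add: power2_eq_square algebra_simps)
  then have prod: "t1 * t2 = of_real c" using q1 b z0 by simp
  \<comment> \<open>The hypotheses give only weak signs. Since the inverse of \<open>s1\<close> lies
    strictly in the opposite half-plane, \<open>s1\<close> cannot be real.\<close>
  have "Im (1 / s1) * Im z < 0"
    using inverse_root_Im[OF z _ s1_0 Im1 root1] c z by (smt (verit) zero_less_power2)
  then have "Im s1 * Im z \<noteq> 0" using z by (auto simp: Im_divide)
  then have "0 < Im s1 * Im z" using Im1 by (metis order_less_le)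
  \<comment> \<open>Subtracting \<open>(c - 1) / z\<close> pushes further into the half-plane of
    \<open>z\<close>, because \<open>c \<ge> 1\<close>.\<close>
  moreover have "Im t1 * Im z = Im s1 * Im z + (c - 1) * (Im z)\<^sup>2 / (cmod z)\<^sup>2"
  proof -
    have "Im (of_real a / z) = - (a * Im z / (cmod z)\<^sup>2)" for a
      by (simp add: Im_divide cmod_power2)
    from this[of "c - 1"] have "Im t1 = Im s1 + (c - 1) * Im z / (cmod z)\<^sup>2" by (simp add: t1_def)
    then show ?thesis by (simp add: distrib_right power2_eq_square)
  qed
  ultimately have t1: "0 < Im t1 * Im z" using c by (simp add: add_pos_nonneg)
  then have "t1 \<noteq> 0" by auto
  then have "t2 = of_real c / t1" using prod by (simp add: field_simps)
  then have "Im t2 * Im z = - (c * (Im t1 * Im z) / (cmod t1)\<^sup>2)"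
    by (simp add: Im_divide cmod_power2)
  also have "\<dots> < 0" using t1 c \<open>t1 \<noteq> 0\<close> by simp
  finally have "Im t2 * Im z < 0" .
  moreover have "Im t2 * Im z = c * (Im s2 * Im z)" by (simp add: t2_def)
  ultimately show False using Im2 c by (smt (verit) mult_nonneg_nonneg)
qed

section \<open>The mean square bound\<close>

lemma resolvent_measurable:
  assumes Y: "\<And>j i. j \<in> set js \<Longrightarrow> i < n \<Longrightarrow> (\<lambda>\<omega>. Y \<omega> j i) \<in> borel_measurable M"
  shows "(\<lambda>\<omega>. resolvent n z (map (Y \<omega>) js) i k) \<in> borel_measurable M"
  using Y
proof (induction js arbitrary: i k)
  case (Cons j js)
  have [measurable]: "(\<lambda>\<omega>. resolvent n z (map (Y \<omega>) js) i k) \<in> borel_measurable M" for i k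
    using Cons by simp
  have Yj: "i < n \<Longrightarrow> (\<lambda>\<omega>. Y \<omega> j i) \<in> borel_measurable M" for i using Cons.prems by simp
  have row: "(\<lambda>\<omega>. \<Sum>l<n. resolvent n z (map (Y \<omega>) js) i l * complex_of_real (Y \<omega> j l)) \<in> borel_measurable M" for i
    by (intro borel_measurable_sum borel_measurable_times measurable_compose[OF _ borel_measurable_of_real]) (auto intro: Yj)
  have "(\<lambda>\<omega>. bilin n (resolvent n z (map (Y \<omega>) js)) (Y \<omega> j)) \<in> borel_measurable M"
    unfolding bilin_def
    by (intro borel_measurable_sum borel_measurable_times measurable_compose[OF _ borel_measurable_of_real] row) (auto intro: Yj)
  with row show ?case by simp
qed simp

definition fluctuation :: "nat \<Rightarrow> nat \<Rightarrow> complex \<Rightarrow> (nat \<Rightarrow> nat \<Rightarrow> real) \<Rightarrow> nat \<Rightarrow> real" where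
  "fluctuation n m z \<omega> j = cmod (bilin n (resolvent n z (leave_out m j (column n \<omega>))) (column n \<omega> j)
     - trc n (resolvent n z (leave_out m j (column n \<omega>))) / of_nat n)"

lemma leave_out_cong: "(\<And>k. k < m \<Longrightarrow> k \<noteq> j \<Longrightarrow> Y k = Y' k) \<Longrightarrow> leave_out m j Y = leave_out m j Y'"
  by (auto simp: leave_out_def)

context gibbs_isotropic
begin

abbreviation "\<Omega> m \<equiv> sample_space n m \<mu>"

lemma prob_space_sample: "prob_space (Pi\<^sub>M I (\<lambda>_. \<mu>))"
  by (rule prob_space_PiM) (rule prob)

lemma coordinate_measurable:
  "j < m \<Longrightarrow> i < n \<Longrightarrow> (\<lambda>\<omega>. column n \<omega> j i) \<in> borel_measurable (\<Omega> m)"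
proof -
  assume ji: "j < m" "i < n"
  have "(\<lambda>\<omega>. \<omega> j) \<in> measurable (\<Omega> m) \<mu>"
    unfolding sample_space_def using ji by (intro measurable_component_singleton) simp
  moreover have "(\<lambda>x. x i) \<in> borel_measurable \<mu>" using ji by simp
  ultimately have "(\<lambda>\<omega>. \<omega> j i) \<in> borel_measurable (\<Omega> m)" by (rule measurable_compose)
  then show ?thesis by (simp add: column_def Ymat_def)
qed

lemma fluctuation_measurable:
  assumes "j < m"
  shows "(\<lambda>\<omega>. fluctuation n m z \<omega> j) \<in> borel_measurable (\<Omega> m)"
proof -
  have [measurable]: "(\<lambda>\<omega>. resolvent n z (leave_out m j (column n \<omega>)) i k) \<in> borel_measurable (\<Omega> m)" for i k
    unfolding leave_out_def
    by (rule resolvent_measurable) (auto simp: set_remove1_eq intro!: coordinate_measurable)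
  have "(\<lambda>\<omega>. bilin n (resolvent n z (leave_out m j (column n \<omega>))) (column n \<omega> j)) \<in> borel_measurable (\<Omega> m)"
    unfolding bilin_def
    by (intro borel_measurable_sum borel_measurable_times measurable_compose[OF _ borel_measurable_of_real])
       (auto intro: coordinate_measurable assms)
  moreover have "(\<lambda>\<omega>. trc n (resolvent n z (leave_out m j (column n \<omega>)))) \<in> borel_measurable (\<Omega> m)"
    unfolding trc_def by measurable
  ultimately show ?thesis unfolding fluctuation_def by measurable
qed

text \<open>The real and imaginary parts of \<open>B\<close> are real symmetric matrices, the form
  in a real vector splits accordingly, and their squared Frobenius norms add up to that of
  \<open>B\<close>.\<close>

lemma complex_quadratic_form_variance:
  fixes B :: "nat \<Rightarrow> nat \<Rightarrow> complex"
  assumes sym: "\<And>i k. B i k = B k i" and n: "n > 0"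
  shows "(\<integral>\<^sup>+x. ennreal ((cmod (bilin n B (\<lambda>i. x i / sqrt (real n)) - trc n B / of_nat n))\<^sup>2) \<partial>\<mu>)
    \<le> ennreal (64 * C / (real n)\<^sup>2 * (\<Sum>i<n. \<Sum>k<n. (cmod (B i k))\<^sup>2))"
proof -
  let ?q = "\<lambda>A x. (\<Sum>i<n. \<Sum>j<n. A i j * x i * x j) - (\<Sum>i<n. A i i) :: real"
  let ?R = "\<lambda>i k. Re (B i k)" and ?I = "\<lambda>i k. Im (B i k)"
  have [measurable]: "?q A \<in> borel_measurable (lebesgue_Rn n)" for A
    by (intro borel_measurable_diff borel_measurable_sum borel_measurable_times measurable_coordinate_Rn) auto
  have sq: "complex_of_real (sqrt (real n)) * complex_of_real (sqrt (real n)) = of_nat n"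
    by (simp flip: of_real_mult)
  have eq: "(cmod (bilin n B (\<lambda>i. x i / sqrt (real n)) - trc n B / of_nat n))\<^sup>2
    = 1 / (real n)\<^sup>2 * ((?q ?R x)\<^sup>2 + (?q ?I x)\<^sup>2)" for x
  proof -
    define w where "w = (\<Sum>i<n. \<Sum>k<n. B i k * of_real (x i * x k)) - trc n B"
    have "bilin n B (\<lambda>i. x i / sqrt (real n)) = (\<Sum>i<n. \<Sum>k<n. B i k * of_real (x i * x k)) / of_nat n"
      unfolding bilin_def sum_distrib_left sum_divide_distrib
      by (intro sum.cong refl) (simp add: sq[symmetric] mult_ac)
    then have "bilin n B (\<lambda>i. x i / sqrt (real n)) - trc n B / of_nat n = w / of_nat n"
      by (simp add: w_def diff_divide_distrib)
    moreover have "Re w = ?q ?R x" "Im w = ?q ?I x"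
      by (simp_all add: w_def trc_def mult.assoc)
    ultimately show ?thesis
      using cmod_power2[of w] by (simp add: norm_divide power_divide)
  qed
  have "(\<integral>\<^sup>+x. ennreal ((cmod (bilin n B (\<lambda>i. x i / sqrt (real n)) - trc n B / of_nat n))\<^sup>2) \<partial>\<mu>)
    = (\<integral>\<^sup>+x. ennreal (1 / (real n)\<^sup>2) * (ennreal ((?q ?R x)\<^sup>2) + ennreal ((?q ?I x)\<^sup>2)) \<partial>\<mu>)"
    unfolding eq by (intro nn_integral_cong) (simp only: ennreal_mult ennreal_plus zero_le_power2
        add_nonneg_nonneg divide_nonneg_nonneg zero_le_one)
  also have "\<dots> = ennreal (1 / (real n)\<^sup>2) * ((\<integral>\<^sup>+x. ennreal ((?q ?R x)\<^sup>2) \<partial>\<mu>) + (\<integral>\<^sup>+x. ennreal ((?q ?I x)\<^sup>2) \<partial>\<mu>))"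
    by (simp add: nn_integral_cmult nn_integral_add)
  also have "\<dots> \<le> ennreal (1 / (real n)\<^sup>2) * (ennreal (64 * C * (\<Sum>i<n. \<Sum>j<n. (?R i j)\<^sup>2)) + ennreal (64 * C * (\<Sum>i<n. \<Sum>j<n. (?I i j)\<^sup>2)))"
    by (intro mult_left_mono add_mono quadratic_form_variance) (simp_all add: sym)
  also have "\<dots> = ennreal (64 * C / (real n)\<^sup>2 * (\<Sum>i<n. \<Sum>k<n. (cmod (B i k))\<^sup>2))"
    using Cpos
    by (simp add: cmod_power2 sum.distrib sum_nonneg ennreal_mult[symmetric] ennreal_plus[symmetric]
        distrib_left del: ennreal_plus)
  finally show ?thesis .
qed

text \<open>Fubini with the \<open>j\<close>-th column innermost: with the other columns frozen, the
  leave-one-out resolvent is a constant matrix whose Frobenius norm is bounded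
  deterministically.\<close>

lemma fluctuation_L2:
  assumes z: "Im z \<noteq> 0" and n: "n > 0" and j: "j < m"
  shows "(\<integral>\<^sup>+\<omega>. ennreal ((fluctuation n m z \<omega> j)\<^sup>2) \<partial>\<Omega> m) \<le> ennreal (64 * C / (real n * (Im z)\<^sup>2))"
proof -
  interpret prob_space \<mu> by (rule prob)
  interpret product_sigma_finite "\<lambda>_::nat. \<mu>" ..
  let ?I = "{..<m} - {j}" and ?K = "ennreal (64 * C / (real n * (Im z)\<^sup>2))"
  interpret P: prob_space "Pi\<^sub>M ?I (\<lambda>_. \<mu>)" by (rule prob_space_sample)
  have ins: "{..<m} = insert j ?I" using j by auto
  have meas: "(\<lambda>\<omega>. ennreal ((fluctuation n m z \<omega> j)\<^sup>2)) \<in> borel_measurable (Pi\<^sub>M (insert j ?I) (\<lambda>_. \<mu>))"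
    using fluctuation_measurable[OF j, of z] unfolding sample_space_def ins[symmetric] by measurable
  have "(\<integral>\<^sup>+\<omega>. ennreal ((fluctuation n m z \<omega> j)\<^sup>2) \<partial>\<Omega> m)
    = (\<integral>\<^sup>+\<omega>. (\<integral>\<^sup>+x. ennreal ((fluctuation n m z (fun_upd \<omega> j x) j)\<^sup>2) \<partial>\<mu>) \<partial>Pi\<^sub>M ?I (\<lambda>_. \<mu>))"
    unfolding sample_space_def
    by (subst ins, rule product_nn_integral_insert) (use meas in auto)
  also have "\<dots> \<le> (\<integral>\<^sup>+\<omega>. ?K \<partial>Pi\<^sub>M ?I (\<lambda>_. \<mu>))"
  proof (rule nn_integral_mono)
    fix \<omega>
    define B where "B = resolvent n z (leave_out m j (column n \<omega>))"
    have "leave_out m j (column n (fun_upd \<omega> j x)) = leave_out m j (column n \<omega>)" for x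
      by (rule leave_out_cong) (simp add: column_def Ymat_def fun_eq_iff)
    moreover have "column n (fun_upd \<omega> j x) j = (\<lambda>i. x i / sqrt (real n))" for x
      by (simp add: column_def Ymat_def fun_eq_iff)
    ultimately have "(\<integral>\<^sup>+x. ennreal ((fluctuation n m z (fun_upd \<omega> j x) j)\<^sup>2) \<partial>\<mu>)
      = (\<integral>\<^sup>+x. ennreal ((cmod (bilin n B (\<lambda>i. x i / sqrt (real n)) - trc n B / of_nat n))\<^sup>2) \<partial>\<mu>)"
      by (simp add: fluctuation_def B_def)
    also have "\<dots> \<le> ennreal (64 * C / (real n)\<^sup>2 * (\<Sum>i<n. \<Sum>k<n. (cmod (B i k))\<^sup>2))"
      by (rule complex_quadratic_form_variance[OF _ n]) (simp add: B_def resolvent_sym[of n z _ _])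
    also have "\<dots> \<le> ennreal (64 * C / (real n)\<^sup>2 * (real n / (Im z)\<^sup>2))"
      using Cpos unfolding B_def by (intro ennreal_leI mult_left_mono resolvent_frobenius[OF z]) auto
    also have "64 * C / (real n)\<^sup>2 * (real n / (Im z)\<^sup>2) = 64 * C / (real n * (Im z)\<^sup>2)"
      using n by (simp add: power2_eq_square)
    finally show "(\<integral>\<^sup>+x. ennreal ((fluctuation n m z (fun_upd \<omega> j x) j)\<^sup>2) \<partial>\<mu>) \<le> ?K" .
  qed
  also have "\<dots> = ?K" by (simp add: P.emeasure_space_1)
  finally show ?thesis .
qed

text \<open>The fluctuations of different columns are dependent, so their sum is treated by
  Cauchy-Schwarz without using cancellation. Each has mean square of order \<open>1 / n\<close>, and
  so has their average.\<close>

lemma snm_L2: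
  fixes z s1 :: complex and c :: real and m :: nat
  defines "r \<equiv> real m / real n" and "v \<equiv> \<bar>Im z\<bar>"
  assumes z: "Im z \<noteq> 0" and c: "c \<ge> 0" and s1: "0 \<le> Im s1 * Im z" "cmod s1 \<le> 1 / \<bar>Im z\<bar>"
    and root: "stieltjes_pol c z s1 = 0" and n: "n > 0"
  shows "(\<integral>\<^sup>+\<omega>. ennreal ((cmod (snm n m \<omega> z - (2 * s1 - (of_real c - 1) / z) / (1 + of_real c)))\<^sup>2) \<partial>\<Omega> m)
    \<le> ennreal (512 * C * r\<^sup>2 / (real n * v ^ 6) + 2 * (2 * r / (real n * v ^ 3) + 2 * \<bar>r - c\<bar> / v ^ 3 + 4 * \<bar>r - c\<bar> / v)\<^sup>2)"
proof -
  interpret S: prob_space "\<Omega> m" unfolding sample_space_def by (rule prob_space_sample)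
  define D where "D = 2 * r / (real n * v ^ 3) + 2 * \<bar>r - c\<bar> / v ^ 3 + 4 * \<bar>r - c\<bar> / v"
  define a where "a = 2 / (v\<^sup>2 * real n)"
  have v: "v > 0" using z by (simp add: v_def)
  have s10: "s1 \<noteq> 0" using root z by (auto simp: stieltjes_pol_def)
  let ?f = "fluctuation n m z"
  have pt: "(cmod (snm n m \<omega> z - (2 * s1 - (of_real c - 1) / z) / (1 + of_real c)))\<^sup>2
    \<le> 2 * a\<^sup>2 * real m * (\<Sum>j<m. (?f \<omega> j)\<^sup>2) + 2 * D\<^sup>2" for \<omega>
  proof -
    let ?X = "cmod (snm n m \<omega> z - (2 * s1 - (of_real c - 1) / z) / (1 + of_real c))"
    have "?X \<le> 2 * cmod (trc n (resolvent n z (map (column n \<omega>) [0..<m])) / of_nat n - s1) + 4 * \<bar>r - c\<bar> / v"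
      unfolding r_def v_def by (rule snm_deviation[OF z n c s1(2)])
    also have "cmod (trc n (resolvent n z (map (column n \<omega>) [0..<m])) / of_nat n - s1)
      \<le> 1 / v\<^sup>2 * (\<Sum>j<m. ?f \<omega> j) / real n + r / (real n * v ^ 3) + \<bar>r - c\<bar> / v ^ 3"
      using stieltjes_deviation[OF z c s10 s1(1) root n, where m = m and Y = "column n \<omega>"]
      by (simp add: r_def v_def fluctuation_def)
    finally have "?X \<le> 2 * (1 / v\<^sup>2 * (\<Sum>j<m. ?f \<omega> j) / real n + r / (real n * v ^ 3) + \<bar>r - c\<bar> / v ^ 3) + 4 * \<bar>r - c\<bar> / v"
      by simp
    also have "\<dots> = a * (\<Sum>j<m. ?f \<omega> j) + D"
      by (simp add: a_def D_def distrib_left)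
    finally have "?X\<^sup>2 \<le> (a * (\<Sum>j<m. ?f \<omega> j) + D)\<^sup>2"
      by (rule power_mono) simp
    also have "\<dots> \<le> 2 * (a * (\<Sum>j<m. ?f \<omega> j))\<^sup>2 + 2 * D\<^sup>2"
      using zero_le_power2[of "a * (\<Sum>j<m. ?f \<omega> j) - D"] by (simp add: power2_eq_square algebra_simps)
    also have "(a * (\<Sum>j<m. ?f \<omega> j))\<^sup>2 \<le> a\<^sup>2 * (real m * (\<Sum>j<m. (?f \<omega> j)\<^sup>2))"
      unfolding power_mult_distrib
      using Cauchy_Schwarz_ineq_sum[of "\<lambda>_. 1" "?f \<omega>" "{..<m}"] by (intro mult_left_mono) auto
    finally show ?thesis by (simp add: mult.assoc)
  qed
  have [measurable]: "(\<lambda>\<omega>. \<Sum>j<m. ennreal ((?f \<omega> j)\<^sup>2)) \<in> borel_measurable (\<Omega> m)"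
    by (intro borel_measurable_sum measurable_compose[OF _ measurable_ennreal] borel_measurable_power fluctuation_measurable) auto
  have a0: "0 \<le> 2 * a\<^sup>2 * real m" by simp
  have "(\<integral>\<^sup>+\<omega>. ennreal ((cmod (snm n m \<omega> z - (2 * s1 - (of_real c - 1) / z) / (1 + of_real c)))\<^sup>2) \<partial>\<Omega> m)
    \<le> (\<integral>\<^sup>+\<omega>. ennreal (2 * a\<^sup>2 * real m) * (\<Sum>j<m. ennreal ((?f \<omega> j)\<^sup>2)) + ennreal (2 * D\<^sup>2) \<partial>\<Omega> m)"
  proof (rule nn_integral_mono)
    fix \<omega>
    have "ennreal (2 * a\<^sup>2 * real m * (\<Sum>j<m. (?f \<omega> j)\<^sup>2) + 2 * D\<^sup>2)
      = ennreal (2 * a\<^sup>2 * real m) * (\<Sum>j<m. ennreal ((?f \<omega> j)\<^sup>2)) + ennreal (2 * D\<^sup>2)"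
      by (subst ennreal_plus) (auto simp: sum_nonneg ennreal_mult[OF a0])
    with ennreal_leI[OF pt[of \<omega>]]
    show "ennreal ((cmod (snm n m \<omega> z - (2 * s1 - (of_real c - 1) / z) / (1 + of_real c)))\<^sup>2)
      \<le> ennreal (2 * a\<^sup>2 * real m) * (\<Sum>j<m. ennreal ((?f \<omega> j)\<^sup>2)) + ennreal (2 * D\<^sup>2)" by simp
  qed
  also have "\<dots> = ennreal (2 * a\<^sup>2 * real m) * (\<integral>\<^sup>+\<omega>. (\<Sum>j<m. ennreal ((?f \<omega> j)\<^sup>2)) \<partial>\<Omega> m) + ennreal (2 * D\<^sup>2)"
    by (subst nn_integral_add) (simp_all add: nn_integral_cmult S.emeasure_space_1 del: sum_ennreal)
  also have "(\<integral>\<^sup>+\<omega>. (\<Sum>j<m. ennreal ((?f \<omega> j)\<^sup>2)) \<partial>\<Omega> m) = (\<Sum>j<m. \<integral>\<^sup>+\<omega>. ennreal ((?f \<omega> j)\<^sup>2) \<partial>\<Omega> m)"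
    by (intro nn_integral_sum measurable_compose[OF _ measurable_ennreal] borel_measurable_power fluctuation_measurable) auto
  also have "\<dots> \<le> (\<Sum>j<m. ennreal (64 * C / (real n * (Im z)\<^sup>2)))"
    by (intro sum_mono fluctuation_L2[OF z n]) auto
  also have "\<dots> = ennreal (real m * (64 * C / (real n * v\<^sup>2)))"
    using Cpos by (simp add: v_def ennreal_mult[symmetric] ennreal_of_nat_eq_real_of_nat)
  finally have "(\<integral>\<^sup>+\<omega>. ennreal ((cmod (snm n m \<omega> z - (2 * s1 - (of_real c - 1) / z) / (1 + of_real c)))\<^sup>2) \<partial>\<Omega> m)
    \<le> ennreal (2 * a\<^sup>2 * real m) * ennreal (real m * (64 * C / (real n * v\<^sup>2))) + ennreal (2 * D\<^sup>2)"
    by (simp add: mult_left_mono add_mono)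
  also have "\<dots> = ennreal (2 * a\<^sup>2 * real m * (real m * (64 * C / (real n * v\<^sup>2))) + 2 * D\<^sup>2)"
    using Cpos by (simp add: ennreal_mult[symmetric] ennreal_plus[symmetric] del: ennreal_plus)
  \<comment> \<open>The factor 512 is \<open>2 * 2\<^sup>2 * 64\<close>: from squaring a sum of two
    terms, from \<open>a\<close>, and from \<open>fluctuation_L2\<close>.\<close>
  also have "2 * a\<^sup>2 * real m * (real m * (64 * C / (real n * v\<^sup>2))) = 512 * C * r\<^sup>2 / (real n * v ^ 6)"
    using v n by (simp add: a_def r_def field_simps power2_eq_square eval_nat_numeral)
  finally show ?thesis by (simp add: D_def)
qed

end

text \<open>Under a finite nonnegative integral only measurability could prevent integrability, and
  then the Bochner integral is 0 by convention. Thus measurability of \<open>snm\<close> does not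
  have to be established.\<close>

lemma integral_le_of_nn_integral_le:
  fixes f :: "'a \<Rightarrow> real"
  assumes "\<And>x. 0 \<le> f x" and "(\<integral>\<^sup>+x. ennreal (f x) \<partial>M) \<le> ennreal e" and "0 \<le> e"
  shows "(\<integral>x. f x \<partial>M) \<le> e"
proof (cases "integrable M f")
  case True
  then have "ennreal (\<integral>x. f x \<partial>M) \<le> ennreal e"
    using assms nn_integral_eq_integral[OF True] by simp
  then show ?thesis using assms(3) by (simp add: ennreal_le_iff)
qed (simp add: not_integrable_integral_eq assms)

text \<open>\<open>p n\<close> bounds \<open>1 / |Im z|\<close>. The fluctuation term requires
  \<open>p n ^ 6\<close> to be small against \<open>n\<close>, and 6/13 is below 1; in the other
  terms \<open>shift\<close> makes \<open>r n - c\<close> of order \<open>1 / n\<close>, whereas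
  mere convergence of \<open>r\<close> would not beat \<open>p n ^ 3\<close>.\<close>

lemma rate_tendsto_zero:
  fixes r :: "nat \<Rightarrow> real"
  assumes r: "r \<longlonglongrightarrow> c" and shift: "(\<lambda>n. real n * (c - r n)) \<longlonglongrightarrow> \<sigma>"
  defines "p \<equiv> \<lambda>n. real n powr (1 / 13)"
  shows "(\<lambda>n. K * (r n)\<^sup>2 / real n * p n ^ 6
    + 2 * (2 * r n / real n * p n ^ 3 + 2 * \<bar>r n - c\<bar> * p n ^ 3 + 4 * \<bar>r n - c\<bar> * p n)\<^sup>2) \<longlonglongrightarrow> 0"
proof -
  have p: "(\<lambda>n. p n ^ 6 / real n) \<longlonglongrightarrow> 0" "(\<lambda>n. p n ^ 3 / real n) \<longlonglongrightarrow> 0" "(\<lambda>n. p n / real n) \<longlonglongrightarrow> 0"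
    unfolding p_def by real_asymp+
  have eq: "\<forall>\<^sub>F n in sequentially.
    K * (r n)\<^sup>2 * (p n ^ 6 / real n) + 2 * (2 * r n * (p n ^ 3 / real n) + 2 * \<bar>real n * (c - r n)\<bar> * (p n ^ 3 / real n)
      + 4 * \<bar>real n * (c - r n)\<bar> * (p n / real n))\<^sup>2
    = K * (r n)\<^sup>2 / real n * p n ^ 6
    + 2 * (2 * r n / real n * p n ^ 3 + 2 * \<bar>r n - c\<bar> * p n ^ 3 + 4 * \<bar>r n - c\<bar> * p n)\<^sup>2"
    using eventually_gt_at_top[of 0] by eventually_elim (simp add: abs_mult abs_minus_commute mult.assoc)
  have "(\<lambda>n. K * (r n)\<^sup>2 * (p n ^ 6 / real n) + 2 * (2 * r n * (p n ^ 3 / real n) + 2 * \<bar>real n * (c - r n)\<bar> * (p n ^ 3 / real n)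
      + 4 * \<bar>real n * (c - r n)\<bar> * (p n / real n))\<^sup>2)
    \<longlonglongrightarrow> K * c\<^sup>2 * 0 + 2 * (2 * c * 0 + 2 * \<bar>\<sigma>\<bar> * 0 + 4 * \<bar>\<sigma>\<bar> * 0)\<^sup>2"
    by (intro tendsto_intros r shift p)
  then show ?thesis using eq by (simp add: Lim_transform_eventually)
qed

text \<open>The supremum over \<open>z\<close> appears as one threshold in \<open>n\<close> that
  serves all \<open>z\<close> at once. In \<open>s1_form\<close> and \<open>s2_form\<close> the
  square root is some \<open>w\<close> with the right square; \<open>s1_st\<close> and
  \<open>s2_st\<close> decide between the two roots of each quadratic.\<close>

theorem theorem2p1:
  fixes V :: "nat \<Rightarrow> (nat \<Rightarrow> real) \<Rightarrow> real"
    and Z :: "nat \<Rightarrow> real"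
    and C \<mu> c \<sigma> R :: real
    and m :: "nat \<Rightarrow> nat"
    and s1 s2 :: "complex \<Rightarrow> complex"
  assumes C2: "\<And>n. C2_Rn n (V n)"
    and Zpos: "\<And>n. Z n > 0"
    and prob: "\<And>n. prob_space (gibbs_law n (V n) (Z n))"
    and int1: "\<And>n i. i < n \<Longrightarrow> integrable (gibbs_law n (V n) (Z n)) (\<lambda>x. x i)"
    and mean: "\<And>n i. i < n \<Longrightarrow> (\<integral>x. x i \<partial>gibbs_law n (V n) (Z n)) = 0"
    and int2: "\<And>n i j. i < n \<Longrightarrow> j < n \<Longrightarrow>
                 integrable (gibbs_law n (V n) (Z n)) (\<lambda>x. x i * x j)"
    and cov: "\<And>n i j. i < n \<Longrightarrow> j < n \<Longrightarrow>
                 (\<integral>x. x i * x j \<partial>gibbs_law n (V n) (Z n)) = (if i = j then 1 else 0)"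
    and int4: "\<And>n i. i < n \<Longrightarrow> integrable (gibbs_law n (V n) (Z n)) (\<lambda>x. (x i) ^ 4)"
    and fourth: "\<And>n i. i < n \<Longrightarrow> (\<integral>x. (x i) ^ 4 \<partial>gibbs_law n (V n) (Z n)) = \<mu>"
    and Cpos: "C > 0"
    and convex: "\<And>n. hess_ge n (V n) (1 / C)"
    and exch: "\<And>n \<pi>. \<pi> permutes {..<n} \<Longrightarrow>
                 distr (gibbs_law n (V n) (Z n)) (lebesgue_Rn n) (\<lambda>x. restrict (\<lambda>i. x (\<pi> i)) {..<n})
                 = gibbs_law n (V n) (Z n)"
    and c_ge: "c \<ge> 1"
    and ratio: "(\<lambda>n. real (m n) / real n) \<longlonglongrightarrow> c"
    and shift: "(\<lambda>n. c * real n - real (m n)) \<longlonglongrightarrow> \<sigma>"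
    and s1_hol: "s1 holomorphic_on {z. Im z \<noteq> 0}"
    and s1_st: "is_stieltjes_of_prob s1"
    and s1_form: "\<And>z. Im z \<noteq> 0 \<Longrightarrow> \<exists>w. w\<^sup>2 = (z\<^sup>2 - of_real c + 1)\<^sup>2 - 4 * z\<^sup>2 \<and>
                    s1 z = - 1 / (2 * z) * (z\<^sup>2 - of_real c + 1 - w)"
    and s2_hol: "s2 holomorphic_on {z. Im z \<noteq> 0}"
    and s2_st: "is_stieltjes_of_prob s2"
    and s2_form: "\<And>z. Im z \<noteq> 0 \<Longrightarrow> \<exists>w. w\<^sup>2 = (z\<^sup>2 + of_real c - 1)\<^sup>2 - 4 * of_real c * z\<^sup>2 \<and>
                    s2 z = - 1 / (2 * of_real c * z) * (z\<^sup>2 + of_real c - 1 - w)"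
  shows "\<forall>\<epsilon>>0. \<forall>\<^sub>F n in sequentially. \<forall>z\<in>Cdom R (real n powr (- 1 / 13)).
           (\<integral>\<omega>. (cmod (snm n (m n) \<omega> z - (s1 z + of_real c * s2 z) / (1 + of_real c)))\<^sup>2
              \<partial>sample_space n (m n) (gibbs_law n (V n) (Z n))) \<le> \<epsilon>"
proof (intro allI impI)
  fix \<epsilon> :: real assume \<epsilon>: "\<epsilon> > 0"
  define r where "r n = real (m n) / real n" for n
  define p where "p n = real n powr (1 / 13)" for n :: nat
  define \<beta> where "\<beta> n = 512 * C * (r n)\<^sup>2 / real n * p n ^ 6
    + 2 * (2 * r n / real n * p n ^ 3 + 2 * \<bar>r n - c\<bar> * p n ^ 3 + 4 * \<bar>r n - c\<bar> * p n)\<^sup>2" for n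
  have "(\<lambda>n. real n * (c - r n)) \<longlonglongrightarrow> \<sigma>"
    by (rule Lim_transform_eventually[OF shift], use eventually_gt_at_top[of 0] in eventually_elim)
       (simp add: r_def algebra_simps)
  moreover have "r \<longlonglongrightarrow> c" using ratio by (simp add: r_def[abs_def])
  ultimately have "\<beta> \<longlonglongrightarrow> 0"
    unfolding \<beta>_def[abs_def] p_def by (intro rate_tendsto_zero)
  then have "\<forall>\<^sub>F n in sequentially. \<beta> n < \<epsilon>" using \<epsilon> by (rule order_tendstoD)
  then show "\<forall>\<^sub>F n in sequentially. \<forall>z\<in>Cdom R (real n powr (- 1 / 13)).
           (\<integral>\<omega>. (cmod (snm n (m n) \<omega> z - (s1 z + of_real c * s2 z) / (1 + of_real c)))\<^sup>2
              \<partial>sample_space n (m n) (gibbs_law n (V n) (Z n))) \<le> \<epsilon>"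
    using eventually_gt_at_top[of 0]
  proof eventually_elim
    case (elim n)
    then have n: "n > 0" and \<beta>: "\<beta> n < \<epsilon>" by auto
    interpret gibbs_isotropic n "V n" "Z n" C
      by (rule gibbs_isotropic.intro) (rule C2 convex Cpos Zpos prob int2 cov; assumption)+
    show ?case
    proof
      fix z assume "z \<in> Cdom R (real n powr (- 1 / 13))"
      then have zv: "real n powr (- 1 / 13) \<le> \<bar>Im z\<bar>" by (simp add: Cdom_def)
      have pos: "0 < real n powr (- 1 / 13)" using n by simp
      with zv have z: "Im z \<noteq> 0" by linarith
      then have z0: "z \<noteq> 0" by auto
      obtain w1 where w1: "w1\<^sup>2 = (z\<^sup>2 - of_real c + 1)\<^sup>2 - 4 * z\<^sup>2"
          "s1 z = - 1 / (2 * z) * (z\<^sup>2 - of_real c + 1 - w1)"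
        using s1_form[OF z] by blast
      have "w1\<^sup>2 = (z\<^sup>2 - of_real c + 1)\<^sup>2 - 4 * z * z"
        using w1(1) by (simp only: power2_eq_square[of z] mult.assoc)
      from root_of_quadratic[OF z0 this w1(2)]
      have "z * (s1 z)\<^sup>2 + (z\<^sup>2 - of_real c + 1) * s1 z + z = 0" .
      then have root1: "stieltjes_pol c z (s1 z) = 0"
        by (simp add: stieltjes_pol_def power2_eq_square algebra_simps)
      have cz: "of_real c * z \<noteq> 0" using c_ge z0 by simp
      obtain w2 where w2: "w2\<^sup>2 = (z\<^sup>2 + of_real c - 1)\<^sup>2 - 4 * of_real c * z\<^sup>2"
          "s2 z = - 1 / (2 * of_real c * z) * (z\<^sup>2 + of_real c - 1 - w2)"
        using s2_form[OF z] by blast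
      have "w2\<^sup>2 = (z\<^sup>2 + of_real c - 1)\<^sup>2 - 4 * (of_real c * z) * z"
        using w2(1) by (simp only: power2_eq_square[of z] mult.assoc)
      moreover have "s2 z = - 1 / (2 * (of_real c * z)) * (z\<^sup>2 + of_real c - 1 - w2)"
        using w2(2) by (simp only: mult.assoc)
      ultimately have root2: "of_real c * z * (s2 z)\<^sup>2 + (z\<^sup>2 + of_real c - 1) * s2 z + z = 0"
        by (rule root_of_quadratic[OF cz])
      note Im1 = stieltjes_Im_nonneg[OF s1_st z] and Im2 = stieltjes_Im_nonneg[OF s2_st z]
        and n1 = stieltjes_norm_le[OF s1_st z]
      \<comment> \<open>Eliminating \<open>s2\<close> brings the limit into the shape that
        \<open>snm_eq_trc\<close> gives to \<open>snm\<close>, so only \<open>s1\<close> is left to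
        compare.\<close>
      have lim: "(s1 z + of_real c * s2 z) / (1 + of_real c) = (2 * s1 z - (of_real c - 1) / z) / (1 + of_real c)"
        unfolding companion_stieltjes[OF z c_ge root1 Im1 root2 Im2] by simp
      define v where "v = \<bar>Im z\<bar>"
      have v: "v > 0" using z by (simp add: v_def)
      have "1 / v \<le> 1 / real n powr (- 1 / 13)"
        unfolding v_def by (rule frac_le[OF _ _ pos zv]) simp_all
      then have vp: "1 / v \<le> p n" by (simp add: p_def powr_minus_divide)
      have vpk: "1 / v ^ k \<le> p n ^ k" for k
        using power_mono[OF vp, of k] v by (simp add: power_divide)
      have r0: "0 \<le> r n" by (simp add: r_def)
      have "512 * C * (r n)\<^sup>2 / real n * (1 / v ^ 6)
         + 2 * (2 * r n / real n * (1 / v ^ 3) + 2 * \<bar>r n - c\<bar> * (1 / v ^ 3) + 4 * \<bar>r n - c\<bar> * (1 / v))\<^sup>2 \<le> \<beta> n"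
        unfolding \<beta>_def using Cpos r0 v
        by (intro add_mono mult_left_mono power_mono vpk vp) (auto intro!: add_nonneg_nonneg)
      then have le: "512 * C * (r n)\<^sup>2 / (real n * v ^ 6)
         + 2 * (2 * r n / (real n * v ^ 3) + 2 * \<bar>r n - c\<bar> / v ^ 3 + 4 * \<bar>r n - c\<bar> / v)\<^sup>2 \<le> \<epsilon>"
        using \<beta> by simp
      show "(\<integral>\<omega>. (cmod (snm n (m n) \<omega> z - (s1 z + of_real c * s2 z) / (1 + of_real c)))\<^sup>2
              \<partial>sample_space n (m n) (gibbs_law n (V n) (Z n))) \<le> \<epsilon>"
      proof (rule integral_le_of_nn_integral_le)
        show "(\<integral>\<^sup>+\<omega>. ennreal ((cmod (snm n (m n) \<omega> z - (s1 z + of_real c * s2 z) / (1 + of_real c)))\<^sup>2)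
              \<partial>sample_space n (m n) (gibbs_law n (V n) (Z n))) \<le> ennreal \<epsilon>"
          unfolding lim
          by (rule order_trans[OF snm_L2[OF z _ Im1 n1 root1 n] ennreal_leI])
             (use c_ge le in \<open>auto simp: r_def v_def\<close>)
      qed (use \<epsilon> in auto)
    qed
  qed
qed

end
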